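(* Let $n\geq 2$ be an integer and let $\gamma\geq\frac{4}{n-1}$. Then the complete Riemannian manifold $(M,g)=\big(\mathbb{R}\times\mathbb{T}^{n-1},\ \mathrm{d}t^2+e^{2t}g_{\mathbb{T}^{n-1}}\big)$, where $g_{\mathbb{T}^{n-1}}$ is the flat metric on the torus $\mathbb{T}^{n-1}$, satisfies $\lambda_1(-\gamma\Delta+\mathrm{Ric})\geq 0$ and has two ends, but it does not split isometrically.
   Context: For a Riemannian manifold $(M,g)$, the function $\mathrm{Ric}:M\to\mathbb{R}$ is defined by $\mathrm{Ric}(x):=\inf\{\mathrm{Ric}_x(v,v): v\in T_xM,\ g(v,v)=1\}$. For a constant $\gamma\geq 0$, "$M$ satisfies $\lambda_1(-\gamma\Delta+\mathrm{Ric})\geq 0$" means that either of the following two equivalent conditions holds: (i) for all $\varphi\in C^1_c(M)$ one has $\int_M \gamma|\nabla\varphi|^2+\mathrm{Ric}\cdot\varphi^2\geq 0$; (ii) there exist $\alpha\in(0,1)$ and $u\in C^{2,\alpha}(M)$ (Hölder regularity understood locally) with $u>0$ and $-\gamma\Delta u+\mathrm{Ric}\cdot u\geq 0$ on $M$. Here $\Delta=\mathrm{div}\nabla$. "$M$ splits isometrically" means that $(M,g)$ is isometric to a Riemannian product $(\mathbb{R}\times N,\mathrm{d}t^2+g_N)$ for some Riemannian manifold $(N,g_N)$. *)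

theory Defs
  imports "HOL-Analysis.Analysis"
begin

text \<open>
  A manifold is presented by an atlas of local parametrizations, i.e. injective maps from
  open subsets of a Euclidean space onto open subsets of the manifold (inverses of coordinate maps).
  Each parametrization carries the coordinate expression of the metric tensor, so that
  \<open>cmet c y v w\<close> is \<open>g (v\<^sup>i \<partial>\<^sub>i) (w\<^sup>j \<partial>\<^sub>j)\<close> at the point with coordinates \<open>y\<close>.
  Tangent vectors are handled through their coordinate vectors.
\<close>

datatype ('a, 'e) rchart =
  RChart (cdom: "'e set") (cpar: "'e \<Rightarrow> 'a") (cmet: "'e \<Rightarrow> 'e \<Rightarrow> 'e \<Rightarrow> real")

datatype ('a, 'e) rmfd =
  RMfd (mtop: "'a topology") (atlas: "('a, 'e) rchart set")

definition cimage :: "('a, 'e) rchart \<Rightarrow> 'a set" where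
  "cimage c = cpar c ` cdom c"

definition coord :: "('a, 'e) rchart \<Rightarrow> 'a \<Rightarrow> 'e" where
  "coord c = inv_into (cdom c) (cpar c)"


subsection \<open>Differentiability classes on open subsets of Euclidean space\<close>

abbreviation pd :: "('e::real_normed_vector \<Rightarrow> 'f::real_normed_vector) \<Rightarrow> 'e \<Rightarrow> 'e \<Rightarrow> 'f" where
  "pd f y v \<equiv> frechet_derivative f (at y) v"

text \<open>The following is only used on open sets \<open>S\<close>.\<close>

primrec Ck_on :: "nat \<Rightarrow> ('e::euclidean_space \<Rightarrow> 'f::real_normed_vector) \<Rightarrow> 'e set \<Rightarrow> bool" where
  "Ck_on 0 f S \<longleftrightarrow> continuous_on S f"
| "Ck_on (Suc k) f S \<longleftrightarrow>
     (\<forall>y\<in>S. f differentiable (at y)) \<and> (\<forall>b\<in>Basis. Ck_on k (\<lambda>y. pd f y b) S)"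

definition smooth_on :: "('e::euclidean_space \<Rightarrow> 'f::real_normed_vector) \<Rightarrow> 'e set \<Rightarrow> bool" where
  "smooth_on f S \<longleftrightarrow> (\<forall>k. Ck_on k f S)"

definition locally_Hoelder_on :: "real \<Rightarrow> ('e::metric_space \<Rightarrow> real) \<Rightarrow> 'e set \<Rightarrow> bool" where
  "locally_Hoelder_on \<alpha> f S \<longleftrightarrow>
     (\<forall>y\<in>S. \<exists>r>0. \<exists>C. \<forall>x\<in>ball y r \<inter> S. \<forall>z\<in>ball y r \<inter> S. \<bar>f x - f z\<bar> \<le> C * dist x z powr \<alpha>)"


subsection \<open>Riemannian manifolds and isometries\<close>

definition transition ::
  "('a \<Rightarrow> 'b) \<Rightarrow> ('a, 'e) rchart \<Rightarrow> ('b, 'f) rchart \<Rightarrow> 'e \<Rightarrow> 'f" where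
  "transition F c d = coord d \<circ> F \<circ> cpar c"

definition overlap ::
  "('a \<Rightarrow> 'b) \<Rightarrow> ('a, 'e) rchart \<Rightarrow> ('b, 'f) rchart \<Rightarrow> 'e set" where
  "overlap F c d = {y \<in> cdom c. F (cpar c y) \<in> cimage d}"

definition smooth_in_charts ::
  "('a \<Rightarrow> 'b) \<Rightarrow> ('a, 'e::euclidean_space) rchart \<Rightarrow> ('b, 'f::euclidean_space) rchart \<Rightarrow> bool" where
  "smooth_in_charts F c d \<longleftrightarrow> smooth_on (transition F c d) (overlap F c d)"

definition metric_preserving_in_charts ::
  "('a \<Rightarrow> 'b) \<Rightarrow> ('a, 'e::euclidean_space) rchart \<Rightarrow> ('b, 'f::euclidean_space) rchart \<Rightarrow> bool" where
  "metric_preserving_in_charts F c d \<longleftrightarrow>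
     (\<forall>y\<in>overlap F c d. \<forall>v w.
        cmet d (transition F c d y) (pd (transition F c d) y v) (pd (transition F c d) y w) =
        cmet c y v w)"

definition riemannian_chart :: "'a topology \<Rightarrow> ('a, 'e::euclidean_space) rchart \<Rightarrow> bool" where
  "riemannian_chart X c \<longleftrightarrow>
     open (cdom c) \<and> openin X (cimage c) \<and>
     homeomorphic_map (top_of_set (cdom c)) (subtopology X (cimage c)) (cpar c) \<and>
     (\<forall>y\<in>cdom c. bilinear (cmet c y) \<and> (\<forall>v w. cmet c y v w = cmet c y w v) \<and>
                  (\<forall>v. v \<noteq> 0 \<longrightarrow> cmet c y v v > 0)) \<and>
     (\<forall>v w. smooth_on (\<lambda>y. cmet c y v w) (cdom c))"

definition riemannian_manifold :: "('a, 'e::euclidean_space) rmfd \<Rightarrow> bool" where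
  "riemannian_manifold M \<longleftrightarrow>
     Hausdorff_space (mtop M) \<and>
     (\<exists>\<B>. countable \<B> \<and> (\<forall>V\<in>\<B>. openin (mtop M) V) \<and>
          (\<forall>U x. openin (mtop M) U \<and> x \<in> U \<longrightarrow> (\<exists>V\<in>\<B>. x \<in> V \<and> V \<subseteq> U))) \<and>
     topspace (mtop M) = (\<Union>c\<in>atlas M. cimage c) \<and>
     (\<forall>c\<in>atlas M. riemannian_chart (mtop M) c) \<and>
     (\<forall>c\<in>atlas M. \<forall>d\<in>atlas M.
        smooth_in_charts id c d \<and> metric_preserving_in_charts id c d)"

definition riemannian_isometry ::
  "('a, 'e::euclidean_space) rmfd \<Rightarrow> ('b, 'f::euclidean_space) rmfd \<Rightarrow> ('a \<Rightarrow> 'b) \<Rightarrow> bool" where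
  "riemannian_isometry M N F \<longleftrightarrow>
     homeomorphic_map (mtop M) (mtop N) F \<and>
     (\<forall>c\<in>atlas M. \<forall>d\<in>atlas N.
        smooth_in_charts F c d \<and>
        smooth_in_charts (inv_into (topspace (mtop M)) F) d c \<and>
        metric_preserving_in_charts F c d)"

definition isometric ::
  "('a, 'e::euclidean_space) rmfd \<Rightarrow> ('b, 'f::euclidean_space) rmfd \<Rightarrow> bool" where
  "isometric M N \<longleftrightarrow> (\<exists>F. riemannian_isometry M N F)"


subsection \<open>Curvature and differential operators in a chart\<close>

definition christoffel :: "('a, 'e::euclidean_space) rchart \<Rightarrow> 'e \<Rightarrow> 'e \<Rightarrow> 'e \<Rightarrow> 'e" where
  "christoffel c y v w = (THE Z. \<forall>z. cmet c y Z z =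
     (pd (\<lambda>x. cmet c x w z) y v + pd (\<lambda>x. cmet c x v z) y w - pd (\<lambda>x. cmet c x v w) y z) / 2)"

text \<open>\<open>R(u,v)w = \<nabla>\<^sub>u \<nabla>\<^sub>v w - \<nabla>\<^sub>v \<nabla>\<^sub>u w\<close> for constant coordinate fields; with this sign,
  \<open>Ric(v,w) = tr (u \<mapsto> R(u,v)w)\<close> is positive on round spheres.\<close>

definition riemann :: "('a, 'e::euclidean_space) rchart \<Rightarrow> 'e \<Rightarrow> 'e \<Rightarrow> 'e \<Rightarrow> 'e \<Rightarrow> 'e" where
  "riemann c y u v w =
     pd (\<lambda>x. christoffel c x v w) y u - pd (\<lambda>x. christoffel c x u w) y v
     + christoffel c y u (christoffel c y v w) - christoffel c y v (christoffel c y u w)"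

definition ricci :: "('a, 'e::euclidean_space) rchart \<Rightarrow> 'e \<Rightarrow> 'e \<Rightarrow> 'e \<Rightarrow> real" where
  "ricci c y v w = (\<Sum>b\<in>Basis. riemann c y b v w \<bullet> b)"

definition grad_in :: "('a, 'e::euclidean_space) rchart \<Rightarrow> ('e \<Rightarrow> real) \<Rightarrow> 'e \<Rightarrow> 'e" where
  "grad_in c f y = (THE X. \<forall>v. cmet c y X v = pd f y v)"

text \<open>The divergence is the trace of the covariant derivative.\<close>

definition div_in :: "('a, 'e::euclidean_space) rchart \<Rightarrow> ('e \<Rightarrow> 'e) \<Rightarrow> 'e \<Rightarrow> real" where
  "div_in c X y = (\<Sum>b\<in>Basis. (pd X y b + christoffel c y b (X y)) \<bullet> b)"


subsection \<open>Scalar quantities on the manifold\<close>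

text \<open>The quantities below are tensorial, so on a Riemannian manifold they do not depend on
  the choice of the chart around \<open>p\<close>.\<close>

definition chart_at :: "('a, 'e) rmfd \<Rightarrow> 'a \<Rightarrow> ('a, 'e) rchart" where
  "chart_at M p = (SOME c. c \<in> atlas M \<and> p \<in> cimage c)"

definition Ric :: "('a, 'e::euclidean_space) rmfd \<Rightarrow> 'a \<Rightarrow> real" where
  "Ric M p = (let c = chart_at M p; y = coord c p in
     Inf {ricci c y v v | v. cmet c y v v = 1})"

definition laplacian :: "('a, 'e::euclidean_space) rmfd \<Rightarrow> ('a \<Rightarrow> real) \<Rightarrow> 'a \<Rightarrow> real" where
  "laplacian M u p = (let c = chart_at M p in
     div_in c (grad_in c (u \<circ> cpar c)) (coord c p))"

definition grad_norm_sq :: "('a, 'e::euclidean_space) rmfd \<Rightarrow> ('a \<Rightarrow> real) \<Rightarrow> 'a \<Rightarrow> real" where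
  "grad_norm_sq M u p = (let c = chart_at M p; y = coord c p; X = grad_in c (u \<circ> cpar c) y in
     cmet c y X X)"


subsection \<open>The Riemannian volume measure\<close>

text \<open>Determinant of the Gram matrix of a bilinear form with respect to \<open>Basis\<close> (Leibniz formula;
  the library's determinant is restricted to matrices indexed by a finite type).\<close>

definition gram_det :: "('e::euclidean_space \<Rightarrow> 'e \<Rightarrow> real) \<Rightarrow> real" where
  "gram_det g = (\<Sum>\<pi> | \<pi> permutes Basis. of_int (sign \<pi>) * (\<Prod>b\<in>Basis. g b (\<pi> b)))"

definition is_volume_measure :: "('a, 'e::euclidean_space) rmfd \<Rightarrow> 'a measure \<Rightarrow> bool" where
  "is_volume_measure M \<mu> \<longleftrightarrow>
     space \<mu> = topspace (mtop M) \<and>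
     sets \<mu> = sigma_sets (topspace (mtop M)) {U. openin (mtop M) U} \<and>
     (\<forall>c\<in>atlas M. \<forall>B\<in>sets borel. B \<subseteq> cdom c \<longrightarrow>
        emeasure \<mu> (cpar c ` B) = (\<integral>\<^sup>+y\<in>B. ennreal (sqrt (gram_det (cmet c y))) \<partial>lborel))"

definition volume_measure :: "('a, 'e::euclidean_space) rmfd \<Rightarrow> 'a measure" where
  "volume_measure M = (THE \<mu>. is_volume_measure M \<mu>)"


subsection \<open>The spectral condition\<close>

definition Ck_fun :: "nat \<Rightarrow> ('a, 'e::euclidean_space) rmfd \<Rightarrow> ('a \<Rightarrow> real) \<Rightarrow> bool" where
  "Ck_fun k M u \<longleftrightarrow> (\<forall>c\<in>atlas M. Ck_on k (u \<circ> cpar c) (cdom c))"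

definition C1c_fun :: "('a, 'e::euclidean_space) rmfd \<Rightarrow> ('a \<Rightarrow> real) \<Rightarrow> bool" where
  "C1c_fun M \<phi> \<longleftrightarrow> Ck_fun 1 M \<phi> \<and>
     compactin (mtop M) (mtop M closure_of {p \<in> topspace (mtop M). \<phi> p \<noteq> 0})"

definition C2_Hoelder_fun :: "real \<Rightarrow> ('a, 'e::euclidean_space) rmfd \<Rightarrow> ('a \<Rightarrow> real) \<Rightarrow> bool" where
  "C2_Hoelder_fun \<alpha> M u \<longleftrightarrow> Ck_fun 2 M u \<and>
     (\<forall>c\<in>atlas M. \<forall>i\<in>Basis. \<forall>j\<in>Basis.
        locally_Hoelder_on \<alpha> (\<lambda>y. pd (\<lambda>x. pd (u \<circ> cpar c) x i) y j) (cdom c))"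

text \<open>The two equivalent meanings of \<open>\<lambda>\<^sub>1(- \<gamma> \<Delta> + Ric) \<ge> 0\<close>: nonnegativity of the
  quadratic form, and existence of a positive supersolution.\<close>

definition lambda1_nonneg_form :: "real \<Rightarrow> ('a, 'e::euclidean_space) rmfd \<Rightarrow> bool" where
  "lambda1_nonneg_form \<gamma> M \<longleftrightarrow>
     (\<forall>\<phi>. C1c_fun M \<phi> \<longrightarrow>
        0 \<le> (\<integral>p. \<gamma> * grad_norm_sq M \<phi> p + Ric M p * (\<phi> p)\<^sup>2 \<partial>volume_measure M))"

definition lambda1_nonneg_supersolution :: "real \<Rightarrow> ('a, 'e::euclidean_space) rmfd \<Rightarrow> bool" where
  "lambda1_nonneg_supersolution \<gamma> M \<longleftrightarrow>
     (\<exists>\<alpha> u. 0 < \<alpha> \<and> \<alpha> < 1 \<and> C2_Hoelder_fun \<alpha> M u \<and>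
        (\<forall>p\<in>topspace (mtop M). 0 < u p \<and> 0 \<le> - \<gamma> * laplacian M u p + Ric M p * u p))"


subsection \<open>Riemannian distance and completeness\<close>

definition piecewise_C1_curve :: "('a, 'e::euclidean_space) rmfd \<Rightarrow> (real \<Rightarrow> 'a) \<Rightarrow> bool" where
  "piecewise_C1_curve M \<sigma> \<longleftrightarrow>
     continuous_map (top_of_set {0..1}) (mtop M) \<sigma> \<and>
     (\<exists>S. finite S \<and>
        (\<forall>c\<in>atlas M. (coord c \<circ> \<sigma>) C1_differentiable_on {t \<in> {0<..<1} - S. \<sigma> t \<in> cimage c}))"

definition speed :: "('a, 'e::euclidean_space) rmfd \<Rightarrow> (real \<Rightarrow> 'a) \<Rightarrow> real \<Rightarrow> real" where
  "speed M \<sigma> t = (let c = chart_at M (\<sigma> t); v = vector_derivative (coord c \<circ> \<sigma>) (at t) in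
     sqrt (cmet c (coord c (\<sigma> t)) v v))"

definition curve_length :: "('a, 'e::euclidean_space) rmfd \<Rightarrow> (real \<Rightarrow> 'a) \<Rightarrow> ennreal" where
  "curve_length M \<sigma> = (\<integral>\<^sup>+t\<in>{0..1}. ennreal (speed M \<sigma> t) \<partial>lborel)"

text \<open>The distance of points in different components is \<open>\<infinity>\<close>.\<close>

definition rdist :: "('a, 'e::euclidean_space) rmfd \<Rightarrow> 'a \<Rightarrow> 'a \<Rightarrow> ennreal" where
  "rdist M p q = (INF \<sigma>\<in>{\<sigma>. piecewise_C1_curve M \<sigma> \<and> \<sigma> 0 = p \<and> \<sigma> 1 = q}. curve_length M \<sigma>)"

definition complete_manifold :: "('a, 'e::euclidean_space) rmfd \<Rightarrow> bool" where
  "complete_manifold M \<longleftrightarrow>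
     (\<forall>s. range s \<subseteq> topspace (mtop M) \<and>
          (\<forall>\<epsilon>>0. \<exists>N::nat. \<forall>i\<ge>N. \<forall>j\<ge>N. rdist M (s i) (s j) < ennreal \<epsilon>) \<longrightarrow>
          (\<exists>p. limitin (mtop M) s p sequentially))"


subsection \<open>Ends\<close>

text \<open>Freudenthal's definition: an end is a choice of a connected component of the
  complement of every compact set, decreasing with respect to the compact set.\<close>

definition ends :: "'a topology \<Rightarrow> ('a set \<Rightarrow> 'a set) set" where
  "ends X = {e \<in> (\<Pi>\<^sub>E K\<in>{K. compactin X K}.
                   connected_components_of (subtopology X (topspace X - K))).
     \<forall>K L. compactin X K \<and> compactin X L \<and> K \<subseteq> L \<longrightarrow> e L \<subseteq> e K}"


subsection \<open>Products with a line, and the flat torus\<close>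

definition warp_chart ::
  "(real \<Rightarrow> real) \<Rightarrow> ('a, 'e::euclidean_space) rchart \<Rightarrow> (real \<times> 'a, real \<times> 'e) rchart" where
  "warp_chart w c = RChart (UNIV \<times> cdom c) (\<lambda>(t, y). (t, cpar c y))
     (\<lambda>(t, y) (a, v) (b, u). a * b + w t * cmet c y v u)"

text \<open>The manifold \<open>\<real> \<times> N\<close> with the metric \<open>dt\<^sup>2 + w(t) g\<^sub>N\<close>.\<close>

definition warped_line ::
  "(real \<Rightarrow> real) \<Rightarrow> ('a, 'e::euclidean_space) rmfd \<Rightarrow> (real \<times> 'a, real \<times> 'e) rmfd" where
  "warped_line w N = RMfd (prod_topology euclidean (mtop N)) (warp_chart w ` atlas N)"

definition product_line ::
  "('a, 'e::euclidean_space) rmfd \<Rightarrow> (real \<times> 'a, real \<times> 'e) rmfd" where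
  "product_line N = warped_line (\<lambda>t. 1) N"

text \<open>The torus as a product of unit circles, with the metric induced by the angle coordinates.\<close>

definition torus_proj :: "real ^ 'k \<Rightarrow> complex ^ 'k" where
  "torus_proj x = (\<chi> i. cis (x $ i))"

definition flat_torus :: "(complex ^ 'k, real ^ 'k) rmfd" where
  "flat_torus = RMfd (top_of_set {z. \<forall>i. cmod (z $ i) = 1})
     {RChart V torus_proj (\<lambda>y v w. v \<bullet> w) | V. open V \<and> inj_on torus_proj V}"

end

theory Submission
  imports Defs
begin

text \<open>
  All charts share the parametrization \<open>(t, y) \<mapsto> (t, cis y)\<close> of the universal cover and the metric
  \<open>dt\<^sup>2 + e\<^sup>2\<^sup>t |dy|\<^sup>2\<close>, which is hyperbolic, so \<open>Ric = -m\<close> with \<open>m = n - 1\<close>, and only the transition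
  maps (translations by \<open>2\<pi>\<close> times integer vectors) see the torus. The spectral condition holds because
  \<open>e\<^sup>-\<^sup>m\<^sup>t\<^sup>/\<^sup>2\<close> is an eigenfunction of \<open>-\<Delta>\<close> with eigenvalue \<open>m\<^sup>2 / 4\<close>; for the quadratic form this is a weighted
  Hardy inequality along each line \<open>y = const\<close>. The length of a curve dominates its Euclidean length
  up to a factor that is bounded for \<open>t\<close> bounded below, which gives completeness. The two ends are
  \<open>t \<rightarrow> \<plusminus>\<infinity>\<close>. A product structure would give a parallel unit vector field, which is incompatible
  with the curvature.
\<close>

subsection \<open>Smooth functions\<close>

text \<open>The threshold for \<gamma> is the inequality \<gamma> m^2 / 4 \<ge> m, that is, \<gamma>
  times the eigenvalue against the curvature -m. Much of the work comes from quantities that are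
  defined through choices. \<open>chart_at\<close> picks some chart, hence some lift of the point to
  the cover, so different lifts have to be compared by deck transformations.
  \<open>volume_measure\<close> is a definite description, so a volume has to be constructed on a
  fundamental cell and shown to be unique before any integral can be evaluated. Integrability of the
  quadratic form is not given; where it fails the integral is 0 by convention. The chart used by
  \<open>speed\<close> may jump arbitrarily along a curve, so its measurability is not at hand and
  curve lengths are bounded through a measurable minorant. The factor N of a splitting is an
  arbitrary Riemannian manifold, so the contradiction is derived locally, in one chart on each side.
  It rests on the Hessian identity Hess e^t = e^t g of the cusp.\<close>

lemma Ck_on_cong:
  assumes "open S" and "\<And>y. y \<in> S \<Longrightarrow> f y = g y"
  shows "Ck_on k f S \<longleftrightarrow> Ck_on k g S"
  using assms(2)
proof (induction k arbitrary: f g)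
  case 0
  then show ?case by (simp cong: continuous_on_cong)
next
  case (Suc k)
  have d: "f differentiable at y \<longleftrightarrow> g differentiable at y" if "y \<in> S" for y
    unfolding differentiable_def
    using Suc.prems that assms(1) has_derivative_transform_within_open by metis
  have pd: "pd f y b = pd g y b" if "y \<in> S" for y b
  proof (cases "f differentiable at y")
    case True
    then show ?thesis
      using frechet_derivative_transform_within_open[OF True assms(1) that] Suc.prems by metis
  next
    case False
    \<comment> \<open>Without a derivative, \<open>frechet_derivative\<close> is a choice from an
      empty predicate; both predicates are empty, so the two choices agree.\<close>
    then have "\<And>f'. \<not> (f has_derivative f') (at y)" "\<And>f'. \<not> (g has_derivative f') (at y)"
      using d[OF that] unfolding differentiable_def by blast+
    then show ?thesis unfolding frechet_derivative_def by simp
  qed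
  have "Ck_on k (\<lambda>y. pd f y b) S \<longleftrightarrow> Ck_on k (\<lambda>y. pd g y b) S" for b
    by (rule Suc.IH) (rule pd)
  then show ?case using d by simp
qed

lemma Ck_on_const: "Ck_on k (\<lambda>_. c) S"
  by (induction k arbitrary: c) simp_all

text \<open>Meant for transition maps, which are translations near each point but not necessarily
  the same translation on all of the overlap.\<close>

lemma smooth_on_has_derivative_id:
  fixes f :: "'e::euclidean_space \<Rightarrow> 'e"
  assumes "open S" and "\<And>y. y \<in> S \<Longrightarrow> (f has_derivative id) (at y)"
  shows "smooth_on f S"
  unfolding smooth_on_def
proof
  fix k
  show "Ck_on k f S"
  proof (cases k)
    case 0
    then show ?thesis
      using has_derivative_continuous[OF assms(2)] by (auto intro!: continuous_at_imp_continuous_on)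
  next
    case (Suc j)
    have "pd f y b = b" if "y \<in> S" for y b
      using frechet_derivative_at[OF assms(2)[OF that]] by (metis id_apply)
    then have "Ck_on j (\<lambda>y. pd f y b) S" for b
      using Ck_on_cong[OF assms(1), of "\<lambda>y. pd f y b" "\<lambda>_. b"] Ck_on_const by blast
    then show ?thesis
      using Suc differentiableI[OF assms(2)] by auto
  qed
qed

lemma has_derivative_exp_fst:
  "((\<lambda>y::real \<times> 'e::real_normed_vector. K * exp (a * fst y) + C) has_derivative
     (\<lambda>v. K * a * fst v * exp (a * fst y))) (at y)"
  by (auto intro!: derivative_eq_intros simp: algebra_simps)

lemma pd_exp_fst:
  "pd (\<lambda>y::real \<times> 'e::real_normed_vector. K * exp (a * fst y) + C) y v
     = K * a * fst v * exp (a * fst y)"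
  using frechet_derivative_at[OF has_derivative_exp_fst] by metis

text \<open>The family is closed under differentiation, so induction over all constants works. It
  contains the metric coefficients (a = 2, C from the line factor) and the supersolution (C =
  0).\<close>

lemma Ck_on_exp_fst:
  "Ck_on k (\<lambda>y::real \<times> 'e::euclidean_space. K * exp (a * fst y) + C) S"
proof (induction k arbitrary: K C)
  case 0
  then show ?case by (simp, intro continuous_intros)
next
  case (Suc k)
  have "Ck_on k (\<lambda>y. (K * a * fst b) * exp (a * fst y) + 0) S" for b :: "real \<times> 'e"
    by (rule Suc)
  then show ?case
    by (simp add: pd_exp_fst differentiableI[OF has_derivative_exp_fst])
qed

subsection \<open>The covering of the cylinder\<close>

lemma cis_eq_iff: "cis x = cis y \<longleftrightarrow> (\<exists>k::int. x = y + 2 * pi * k)"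
  using sin_cos_eq_iff[of x y] by (auto simp: complex_eq_iff)

lemma torus_proj_eq_iff:
  "torus_proj x = torus_proj y \<longleftrightarrow> (\<exists>k :: int ^ 'k::finite. x = y + (2 * pi) *\<^sub>R (\<chi> i. of_int (k $ i)))"
proof
  assume "torus_proj x = torus_proj y"
  then have "\<forall>i. \<exists>k::int. x $ i = y $ i + 2 * pi * k"
    by (simp add: torus_proj_def vec_eq_iff cis_eq_iff)
  then obtain k :: "'k \<Rightarrow> int" where "\<forall>i. x $ i = y $ i + 2 * pi * k i" by metis
  then show "\<exists>k :: int ^ 'k. x = y + (2 * pi) *\<^sub>R (\<chi> i. of_int (k $ i))"
    by (intro exI[of _ "\<chi> i. k i"]) (simp add: vec_eq_iff)
next
  assume "\<exists>k :: int ^ 'k. x = y + (2 * pi) *\<^sub>R (\<chi> i. of_int (k $ i))"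
  then obtain k :: "int ^ 'k" where "x = y + (2 * pi) *\<^sub>R (\<chi> i. of_int (k $ i))" ..
  then show "torus_proj x = torus_proj y"
    by (auto simp: torus_proj_def vec_eq_iff cis_eq_iff intro!: exI)
qed

definition torus :: "(complex ^ 'k) set" where
  "torus = {z. \<forall>i. cmod (z $ i) = 1}"

definition cyl :: "(real \<times> (complex ^ 'k)) set" where
  "cyl = UNIV \<times> torus"

definition cyl_par :: "real \<times> (real ^ 'k) \<Rightarrow> real \<times> (complex ^ 'k)" where
  "cyl_par = (\<lambda>(t, y). (t, torus_proj y))"

lemma fst_cyl_par [simp]: "fst (cyl_par y) = fst y"
  and snd_cyl_par [simp]: "snd (cyl_par y) = torus_proj (snd y)"
  by (simp_all add: cyl_par_def case_prod_unfold)

lemma torus_proj_in_torus: "torus_proj y \<in> torus"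
  by (simp add: torus_proj_def torus_def)

lemma range_torus_proj: "range (torus_proj :: real ^ 'k::finite \<Rightarrow> _) = torus"
proof -
  have "z \<in> range torus_proj" if "z \<in> torus" for z :: "complex ^ 'k"
  proof
    show "z = torus_proj (\<chi> i. Arg (z $ i))"
      using that by (simp add: vec_eq_iff torus_proj_def torus_def)
        (metis Arg_zero cis_Arg complex_sgn_def divide_inverse norm_zero zero_neq_one
          inverse_1 scaleR_one sgn_div_norm)
  qed simp
  then show ?thesis using torus_proj_in_torus by blast
qed

lemma range_cyl_par: "range (cyl_par :: real \<times> (real ^ 'k::finite) \<Rightarrow> _) = cyl"
proof -
  have "(cyl_par :: real \<times> (real ^ 'k) \<Rightarrow> _) = map_prod id torus_proj"
    by (auto simp: cyl_par_def)
  then show ?thesis by (metis UNIV_Times_UNIV map_prod_image cyl_def image_id id_apply range_torus_proj)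
qed

lemma cyl_par_in_cyl: "cyl_par y \<in> cyl"
  by (simp add: cyl_par_def cyl_def case_prod_unfold torus_proj_in_torus)

lemma continuous_on_torus_proj: "continuous_on S (torus_proj :: real ^ 'k::finite \<Rightarrow> _)"
  unfolding torus_proj_def by (intro continuous_intros)

lemma continuous_on_cyl_par: "continuous_on S (cyl_par :: real \<times> (real ^ 'k::finite) \<Rightarrow> _)"
  unfolding cyl_par_def case_prod_unfold
  by (intro continuous_intros continuous_on_compose2[OF continuous_on_torus_proj]) auto

lemma openin_cyl_par_image:
  fixes U :: "(real \<times> (real ^ 'k::finite)) set"
  assumes "open U"
  shows "openin (top_of_set cyl) (cyl_par ` U)"
proof (subst openin_subopen, rule ballI)
  fix p assume "p \<in> cyl_par ` U"
  then obtain t0 y0 where U: "(t0, y0) \<in> U" and p_def: "p = cyl_par (t0, y0)" by auto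
  \<comment> \<open>A section of the covering through \<open>(t0, y0)\<close>. Rotation by
    \<open>cis (- (y0 $ i))\<close> moves the coordinates of \<open>p\<close> to 1, away from the
    branch cut of \<open>Arg\<close>. Continuity at the single point \<open>p\<close> is enough: it
    gives a neighbourhood of \<open>p\<close> that \<open>h\<close> maps into
    \<open>U\<close>.\<close>
  define h :: "real \<times> (complex ^ 'k) \<Rightarrow> real \<times> (real ^ 'k)"
    where "h = (\<lambda>q. (fst q, \<chi> i. y0 $ i + Arg (snd q $ i * cis (- (y0 $ i)))))"
  have [simp]: "snd p $ i * cis (- (y0 $ i)) = 1" for i
    by (simp add: p_def torus_proj_def cis_mult)
  have hp: "h p = (t0, y0)"
    by (simp add: h_def vec_eq_iff) (simp add: p_def)
  have "isCont (\<lambda>q. Arg (snd q $ i * cis (- (y0 $ i)))) p" for i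
    by (intro continuous_intros isCont_o2[OF _ continuous_at_Arg]) auto
  then have "isCont h p"
    unfolding h_def isCont_def
    by (intro tendsto_Pair tendsto_vec_lambda tendsto_add tendsto_const tendsto_fst tendsto_ident_at)
  then obtain O' where O': "open O'" "p \<in> O'" "\<And>q. q \<in> O' \<Longrightarrow> h q \<in> U"
    using U hp assms unfolding continuous_at_open by metis
  have inv: "cyl_par (h q) = q" if "q \<in> cyl" for q
  proof -
    have "cis (y0 $ i + Arg (snd q $ i * cis (- (y0 $ i)))) = snd q $ i" for i
    proof -
      have n: "cmod (snd q $ i * cis (- (y0 $ i))) = 1"
        using that by (auto simp: cyl_def torus_def norm_mult)
      then have "cis (Arg (snd q $ i * cis (- (y0 $ i)))) = snd q $ i * cis (- (y0 $ i))"
        by (metis cis_Arg norm_zero zero_neq_one sgn_div_norm inverse_1 scaleR_one)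
      then show ?thesis by (simp flip: cis_mult) (simp add: cis_mult mult.left_commute)
    qed
    then show ?thesis by (simp add: h_def cyl_par_def torus_proj_def prod_eq_iff vec_eq_iff)
  qed
  show "\<exists>T. openin (top_of_set cyl) T \<and> p \<in> T \<and> T \<subseteq> cyl_par ` U"
  proof (intro exI conjI)
    show "openin (top_of_set cyl) (cyl \<inter> O')" using O' by auto
    show "p \<in> cyl \<inter> O'" using O' p_def cyl_par_in_cyl by blast
    show "cyl \<inter> O' \<subseteq> cyl_par ` U" using inv O' by (metis IntE image_eqI subsetI)
  qed
qed

lemma closed_torus: "closed (torus :: (complex ^ 'k::finite) set)"
proof -
  have "torus = (\<Inter>i. {z :: complex ^ 'k. cmod (z $ i) = 1})" by (auto simp: torus_def)
  moreover have "closed {z :: complex ^ 'k. cmod (z $ i) = 1}" for i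
    by (intro closed_Collect_eq continuous_intros)
  ultimately show ?thesis by (metis closed_INT)
qed

subsection \<open>The cusp and its charts\<close>

definition cusp :: "(real \<times> (complex ^ 'k), real \<times> (real ^ 'k)) rmfd" where
  "cusp = warped_line (\<lambda>t. exp (2 * t)) flat_torus"

definition cusp_metric :: "real \<times> (real ^ 'k) \<Rightarrow> real \<times> (real ^ 'k) \<Rightarrow> real \<times> (real ^ 'k) \<Rightarrow> real" where
  "cusp_metric y v w = fst v * fst w + exp (2 * fst y) * (snd v \<bullet> snd w)"

definition cusp_chart :: "(real ^ 'k) set \<Rightarrow> (real \<times> (complex ^ 'k), real \<times> (real ^ 'k)) rchart" where
  "cusp_chart V = RChart (UNIV \<times> V) cyl_par cusp_metric"

lemma cusp_chart_simps [simp]: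
  "cdom (cusp_chart V) = UNIV \<times> V"
  "cpar (cusp_chart V) = cyl_par"
  "cmet (cusp_chart V) = cusp_metric"
  by (simp_all add: cusp_chart_def)

lemma mtop_cusp: "mtop (cusp :: (_, real \<times> (real ^ 'k::finite)) rmfd) = top_of_set cyl"
  by (simp add: cusp_def warped_line_def flat_torus_def cyl_def torus_def
    flip: prod_topology_subtopology_eu)

lemma atlas_cusp:
  "atlas (cusp :: (_, real \<times> (real ^ 'k::finite)) rmfd) = cusp_chart ` {V. open V \<and> inj_on torus_proj V}"
proof -
  have "warp_chart (\<lambda>t. exp (2 * t)) (RChart V torus_proj (\<lambda>y v w. v \<bullet> w)) = cusp_chart V"
    for V :: "(real ^ 'k) set"
    by (simp add: warp_chart_def cusp_chart_def cyl_par_def cusp_metric_def fun_eq_iff)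
  then show ?thesis
    by (simp add: cusp_def warped_line_def flat_torus_def setcompr_eq_image image_image)
qed

lemma inj_on_cyl_par: "inj_on torus_proj V \<Longrightarrow> inj_on cyl_par (UNIV \<times> V)"
  by (auto simp: inj_on_def cyl_par_def)

lemma cusp_chart_atlas:
  assumes "c \<in> atlas cusp"
  obtains V :: "(real ^ 'k::finite) set"
    where "open V" "inj_on torus_proj V" "c = cusp_chart V" "inj_on cyl_par (cdom c)"
      "open (cdom c)" "cpar c = cyl_par" "cmet c = cusp_metric"
  using assms inj_on_cyl_par by (fastforce simp: atlas_cusp open_Times)

text \<open>Two points of a cube of side 2 pi cannot differ by a nonzero lattice vector. These cubes
  show that every point of the cover lies in the domain of some chart.\<close>

lemma inj_on_torus_proj_cube:
  fixes y :: "real ^ 'k::finite"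
  shows "inj_on torus_proj {x. \<forall>i. \<bar>x $ i - y $ i\<bar> < pi}"
proof (rule inj_onI)
  fix a b assume *: "a \<in> {x. \<forall>i. \<bar>x $ i - y $ i\<bar> < pi}" "b \<in> {x. \<forall>i. \<bar>x $ i - y $ i\<bar> < pi}"
    "torus_proj a = torus_proj b"
  then obtain k :: "int ^ 'k" where k: "a = b + (2 * pi) *\<^sub>R (\<chi> i. of_int (k $ i))"
    unfolding torus_proj_eq_iff by blast
  have "k $ i = 0" for i
  proof -
    have "2 * pi * k $ i = a $ i - b $ i" by (simp add: k)
    moreover have "\<bar>a $ i - b $ i\<bar> < 2 * pi" using *(1,2)[unfolded mem_Collect_eq, THEN spec, of i] by linarith
    ultimately have "2 * pi * \<bar>real_of_int (k $ i)\<bar> < 2 * pi * 1"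
      by (metis abs_mult abs_of_pos mult.right_neutral pi_gt_zero mult_pos_pos zero_less_numeral)
    then have "\<bar>real_of_int (k $ i)\<bar> < 1" using pi_gt_zero by (simp only: mult_less_cancel_left_pos mult_pos_pos zero_less_numeral)
    then show ?thesis by linarith
  qed
  then show "a = b" by (simp add: k vec_eq_iff)
qed

lemma open_cube: "open {x :: real ^ 'k::finite. \<forall>i. \<bar>x $ i - y $ i\<bar> < r}"
proof -
  have "{x :: real ^ 'k. \<forall>i. \<bar>x $ i - y $ i\<bar> < r} = (\<Inter>i. {x. \<bar>x $ i - y $ i\<bar> < r})" by auto
  moreover have "open {x :: real ^ 'k. \<bar>x $ i - y $ i\<bar> < r}" for i
    by (intro open_Collect_less continuous_intros)
  ultimately show ?thesis by auto
qed

lemma cusp_chart_exists: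
  fixes y :: "real \<times> (real ^ 'k::finite)"
  obtains c where "c \<in> atlas cusp" "y \<in> cdom c"
proof
  let ?V = "{x. \<forall>i. \<bar>x $ i - snd y $ i\<bar> < pi}"
  show "cusp_chart ?V \<in> atlas cusp"
    unfolding atlas_cusp using open_cube inj_on_torus_proj_cube by blast
  show "y \<in> cdom (cusp_chart ?V)" by (cases y) simp
qed

lemma coord_cusp:
  assumes "c \<in> atlas cusp" "y \<in> cdom c"
  shows "coord c (cyl_par y) = y"
proof -
  obtain V where V: "inj_on cyl_par (cdom c)" "cpar c = cyl_par" using cusp_chart_atlas[OF assms(1)] by metis
  then show ?thesis using inv_into_f_f[OF V(1) assms(2)] by (simp add: coord_def)
qed

lemma coord_in_cdom:
  assumes "p \<in> cimage c"
  shows "coord c p \<in> cdom c" "cpar c (coord c p) = p"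
  using assms by (auto simp: cimage_def coord_def inv_into_into f_inv_into_f)

text \<open>One coincidence \<open>cyl_par x = cyl_par z\<close> makes \<open>z - x\<close> a
  lattice vector, so translation by it is a deck transformation of the whole cover.\<close>

lemma cyl_par_translate:
  assumes "cyl_par x = cyl_par z"
  shows "cyl_par (y + (z - x)) = cyl_par (y :: real \<times> (real ^ 'k::finite))"
proof -
  have "torus_proj (snd z) = torus_proj (snd x)" "fst z = fst x"
    using assms by (auto simp: prod_eq_iff)
  then obtain k :: "int ^ 'k" where "snd z = snd x + (2 * pi) *\<^sub>R (\<chi> i. of_int (k $ i))"
    unfolding torus_proj_eq_iff by blast
  then have "torus_proj (snd y + (snd z - snd x)) = torus_proj (snd y)"
    unfolding torus_proj_eq_iff by auto
  with \<open>fst z = fst x\<close> show ?thesis by (simp add: prod_eq_iff)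
qed

lemma openin_cimage_cusp:
  assumes "c \<in> atlas (cusp :: (_, real \<times> (real ^ 'k::finite)) rmfd)"
  shows "openin (top_of_set cyl) (cimage c)"
  using assms unfolding cimage_def by (metis cusp_chart_atlas openin_cyl_par_image)

text \<open>With \<open>z\<close> the image of \<open>y\<close>, the transition map agrees with the
  deck transformation y' \<mapsto> y' + (z - y) as long as the result stays in
  \<open>cdom d\<close>, because coordinates in \<open>cdom d\<close> are unique.\<close>

lemma transition_cusp:
  fixes c d :: "(_, real \<times> (real ^ 'k::finite)) rchart"
  assumes c: "c \<in> atlas cusp" and d: "d \<in> atlas cusp" and y: "y \<in> overlap id c d"
  shows "(transition id c d has_derivative id) (at y)"
proof -
  have cp: "cpar c = cyl_par" "cpar d = cyl_par" "open (cdom d)"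
    using cusp_chart_atlas c d by metis+
  define z where "z = transition id c d y"
  have z: "z \<in> cdom d" "cyl_par z = cyl_par y"
    using y coord_in_cdom[of "cyl_par y" d] cp by (auto simp: z_def overlap_def transition_def)
  have "((\<lambda>y'. y' + (z - y)) has_derivative id) (at y)"
    by (auto intro!: derivative_eq_intros)
  moreover have "open ((\<lambda>y'. y' + (z - y)) -` cdom d)"
    using cp by (intro open_vimage continuous_intros)
  moreover have "y \<in> (\<lambda>y'. y' + (z - y)) -` cdom d" using z by simp
  moreover have "y' + (z - y) = transition id c d y'" if "y' \<in> (\<lambda>y'. y' + (z - y)) -` cdom d" for y'
    using that coord_cusp[OF d, of "y' + (z - y)"] cyl_par_translate[of y z y'] z cp
    by (simp add: transition_def)
  ultimately show ?thesis
    by (rule has_derivative_transform_within_open)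
qed

lemma open_overlap_cusp:
  fixes c d :: "(_, real \<times> (real ^ 'k::finite)) rchart"
  assumes c: "c \<in> atlas cusp" and d: "d \<in> atlas cusp"
  shows "open (overlap id c d)"
proof -
  obtain O' where O': "open O'" "cimage d = cyl \<inter> O'"
    using openin_cimage_cusp[OF d] by (auto simp: openin_open)
  have "open (cdom c)" "cpar c = cyl_par" using cusp_chart_atlas c by metis+
  moreover have "overlap id c d = cdom c \<inter> cyl_par -` O'"
    using O' calculation cyl_par_in_cyl by (auto simp: overlap_def)
  ultimately show ?thesis
    using O' continuous_on_cyl_par by (metis open_Int open_vimage)
qed

lemma homeomorphic_map_cyl_par:
  fixes U :: "(real \<times> (real ^ 'k::finite)) set"
  assumes "open U" "inj_on cyl_par U"
  shows "homeomorphic_map (top_of_set U) (subtopology (top_of_set cyl) (cyl_par ` U)) cyl_par"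
proof (rule bijective_open_imp_homeomorphic_map)
  have sub: "cyl_par ` U \<subseteq> cyl" using cyl_par_in_cyl by blast
  show "continuous_map (top_of_set U) (subtopology (top_of_set cyl) (cyl_par ` U)) cyl_par"
    using sub continuous_on_cyl_par by (auto simp: subtopology_subtopology)
  show "cyl_par ` topspace (top_of_set U) = topspace (subtopology (top_of_set cyl) (cyl_par ` U))"
    using sub by auto
  show "inj_on cyl_par (topspace (top_of_set U))" using assms by simp
  show "open_map (top_of_set U) (subtopology (top_of_set cyl) (cyl_par ` U)) cyl_par"
    unfolding open_map_def
  proof (intro allI impI)
    fix W assume "openin (top_of_set U) W"
    then have "open W" "W \<subseteq> U" using assms(1) openin_open_trans openin_imp_subset by (auto simp: openin_open_eq)
    then show "openin (subtopology (top_of_set cyl) (cyl_par ` U)) (cyl_par ` W)"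
      using openin_cyl_par_image[of W] sub by (metis image_mono openin_subset_topspace_eq openin_subtopology_Int2 inf.absorb_iff2 openin_subtopology)
  qed
qed

lemma riemannian_chart_cusp:
  assumes "c \<in> atlas (cusp :: (_, real \<times> (real ^ 'k::finite)) rmfd)"
  shows "riemannian_chart (top_of_set cyl) c"
proof -
  have c: "cpar c = cyl_par" "open (cdom c)" "inj_on cyl_par (cdom c)" "cmet c = cusp_metric"
    using assms cusp_chart_atlas by metis+
  have "bilinear (cusp_metric y)" for y :: "real \<times> (real ^ 'k)"
    unfolding bilinear_def cusp_metric_def
    by (auto intro!: linearI simp: algebra_simps)
  moreover have "cusp_metric y v w = cusp_metric y w v" for y v w :: "real \<times> (real ^ 'k)"
    by (simp add: cusp_metric_def inner_commute)
  moreover have "cusp_metric y v v > 0" if "v \<noteq> 0" for y v :: "real \<times> (real ^ 'k)"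
  proof (cases "fst v = 0")
    case True
    then have "snd v \<noteq> 0" using that by (auto simp: prod_eq_iff)
    then show ?thesis using True by (simp add: cusp_metric_def)
  next
    case False
    then have "fst v * fst v > 0" by (simp add: zero_less_mult_iff linorder_neq_iff disj_commute)
    then show ?thesis unfolding cusp_metric_def by (intro add_pos_nonneg) auto
  qed
  moreover have "smooth_on (\<lambda>y. cusp_metric y v w) S" for v w :: "real \<times> (real ^ 'k)" and S
    using Ck_on_exp_fst[of _ "snd v \<bullet> snd w" 2 "fst v * fst w" S]
    by (simp add: smooth_on_def cusp_metric_def algebra_simps)
  ultimately show ?thesis
    using c openin_cimage_cusp[OF assms] homeomorphic_map_cyl_par[of "cdom c"]
    by (simp add: riemannian_chart_def cimage_def)
qed

lemma topspace_cusp: "cyl = (\<Union>c\<in>atlas (cusp :: (_, real \<times> (real ^ 'k::finite)) rmfd). cimage c)"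
proof -
  have "p \<in> (\<Union>c\<in>atlas cusp. cimage c)" if "p \<in> cyl" for p :: "real \<times> (complex ^ 'k)"
  proof -
    obtain y where y: "p = cyl_par y" using \<open>p \<in> cyl\<close> unfolding range_cyl_par[symmetric] by blast
    obtain c where "c \<in> atlas cusp" "y \<in> cdom c" using cusp_chart_exists by blast
    moreover have "cpar c = cyl_par" using calculation cusp_chart_atlas by metis
    ultimately show ?thesis using y by (metis UN_I cimage_def image_eqI)
  qed
  moreover have "cimage c \<subseteq> cyl" if "c \<in> atlas cusp" for c :: "(_, real \<times> (real ^ 'k)) rchart"
    using openin_cimage_cusp[OF that] openin_imp_subset by blast
  ultimately show ?thesis by blast
qed

lemma chart_at_cusp:
  fixes p :: "real \<times> (complex ^ 'k::finite)"
  assumes "p \<in> cyl"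
  shows "chart_at cusp p \<in> atlas cusp" "p \<in> cimage (chart_at cusp p)"
proof -
  have "\<exists>c. c \<in> atlas cusp \<and> p \<in> cimage c" using assms topspace_cusp by auto
  then have "chart_at cusp p \<in> atlas cusp \<and> p \<in> cimage (chart_at cusp p)"
    unfolding chart_at_def by (rule someI_ex)
  then show "chart_at cusp p \<in> atlas cusp" "p \<in> cimage (chart_at cusp p)" by auto
qed

lemma riemannian_manifold_cusp: "riemannian_manifold (cusp :: (_, real \<times> (real ^ 'k::finite)) rmfd)"
  unfolding riemannian_manifold_def mtop_cusp
proof (intro conjI ballI)
  show "Hausdorff_space (top_of_set (cyl :: (real \<times> (complex ^ 'k)) set))"
    by (intro Hausdorff_space_subtopology) simp
  obtain B :: "(real \<times> (complex ^ 'k)) set set" where B: "countable B" "\<And>C. C \<in> B \<Longrightarrow> open C"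
    "\<And>S. open S \<Longrightarrow> \<exists>U. U \<subseteq> B \<and> S = \<Union>U"
    using univ_second_countable by blast
  show "\<exists>\<B>. countable \<B> \<and> (\<forall>V\<in>\<B>. openin (top_of_set (cyl :: (real \<times> (complex ^ 'k)) set)) V) \<and>
      (\<forall>U x. openin (top_of_set cyl) U \<and> x \<in> U \<longrightarrow> (\<exists>V\<in>\<B>. x \<in> V \<and> V \<subseteq> U))"
  proof (intro exI[of _ "(\<lambda>C. cyl \<inter> C) ` B"] conjI allI impI ballI)
    show "countable ((\<lambda>C. cyl \<inter> C) ` B)" using B by simp
    show "openin (top_of_set cyl) V" if "V \<in> (\<lambda>C. cyl \<inter> C) ` B" for V using that B by auto
    fix U and x :: "real \<times> (complex ^ 'k)" assume "openin (top_of_set cyl) U \<and> x \<in> U"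
    then obtain S where "open S" and "U = cyl \<inter> S" "x \<in> S" "x \<in> cyl" by (auto simp: openin_open)
    moreover obtain W where "W \<subseteq> B" "S = \<Union>W" using B(3)[OF \<open>open S\<close>] by metis
    ultimately obtain C where "C \<in> B" "x \<in> C" "C \<subseteq> S" "x \<in> cyl" "U = cyl \<inter> S" by auto
    then show "\<exists>V\<in>(\<lambda>C. cyl \<inter> C) ` B. x \<in> V \<and> V \<subseteq> U"
      by (intro bexI[of _ "cyl \<inter> C"]) auto
  qed
  show "topspace (top_of_set cyl) = (\<Union>c\<in>atlas (cusp :: (_, real \<times> (real ^ 'k::finite)) rmfd). cimage c)"
    using topspace_cusp by simp
  fix c d :: "(_, real \<times> (real ^ 'k)) rchart" assume c: "c \<in> atlas cusp"
  show "riemannian_chart (top_of_set cyl) c" using riemannian_chart_cusp[OF c] .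
  assume d: "d \<in> atlas cusp"
  show "smooth_in_charts id c d"
    unfolding smooth_in_charts_def
    using open_overlap_cusp[OF c d] transition_cusp[OF c d] smooth_on_has_derivative_id by blast
  have cd: "cpar c = cyl_par" "cpar d = cyl_par" "cmet c = cusp_metric" "cmet d = cusp_metric"
    using cusp_chart_atlas c d by metis+
  have "fst (transition id c d y) = fst y" if "y \<in> overlap id c d" for y
    using that coord_in_cdom[of "cyl_par y" d] cd
    by (simp add: overlap_def transition_def) (metis fst_cyl_par)
  moreover have "pd (transition id c d) y v = v" if "y \<in> overlap id c d" for y v
    using frechet_derivative_at[OF transition_cusp[OF c d that]] by (metis id_apply)
  ultimately show "metric_preserving_in_charts id c d"
    using cd by (simp add: metric_preserving_in_charts_def cusp_metric_def)
qed

subsection \<open>Curvature and Laplacian of the cusp\<close>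

text \<open>Gives the uniqueness needed to evaluate the definite descriptions in
  \<open>christoffel\<close> and \<open>grad_in\<close>.\<close>

lemma cusp_metric_nondegenerate:
  fixes X Y :: "real \<times> (real ^ 'k::finite)"
  assumes "\<And>z. cusp_metric y X z = cusp_metric y Y z"
  shows "X = Y"
proof -
  have "fst X = fst Y" using assms[of "(1, 0)"] by (simp add: cusp_metric_def)
  moreover have "snd X \<bullet> z = snd Y \<bullet> z" for z
    using assms[of "(0, z)"] by (simp add: cusp_metric_def)
  then have "snd X = snd Y" using vector_eq_rdot[of "snd X" "snd Y"] by blast
  ultimately show ?thesis by (simp add: prod_eq_iff)
qed

lemma pd_cusp_metric:
  "pd (\<lambda>x. cusp_metric x w z) y v = 2 * fst v * exp (2 * fst y) * (snd w \<bullet> snd z)"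
  using pd_exp_fst[of "snd w \<bullet> snd z" 2 "fst w * fst z" y v]
  by (simp add: cusp_metric_def algebra_simps)

lemma christoffel_cusp:
  fixes c :: "(_, real \<times> (real ^ 'k::finite)) rchart"
  assumes "cmet c = cusp_metric"
  shows "christoffel c y v w =
    (- exp (2 * fst y) * (snd v \<bullet> snd w), fst v *\<^sub>R snd w + fst w *\<^sub>R snd v)" (is "_ = ?Z")
  unfolding christoffel_def assms pd_cusp_metric
proof (rule the_equality)
  show *: "\<forall>z. cusp_metric y ?Z z = (2 * fst v * exp (2 * fst y) * (snd w \<bullet> snd z) +
      2 * fst w * exp (2 * fst y) * (snd v \<bullet> snd z) -
      2 * fst z * exp (2 * fst y) * (snd v \<bullet> snd w)) / 2"
    by (simp add: cusp_metric_def inner_add_left field_simps)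
  show "Z = ?Z" if "\<forall>z. cusp_metric y Z z = (2 * fst v * exp (2 * fst y) * (snd w \<bullet> snd z) +
      2 * fst w * exp (2 * fst y) * (snd v \<bullet> snd z) -
      2 * fst z * exp (2 * fst y) * (snd v \<bullet> snd w)) / 2" for Z
    by (rule cusp_metric_nondegenerate[of y]) (simp only: spec[OF that] spec[OF *])
qed

lemma pd_christoffel_cusp:
  fixes c :: "(_, real \<times> (real ^ 'k::finite)) rchart"
  assumes "cmet c = cusp_metric"
  shows "pd (\<lambda>x. christoffel c x v w) y u = (- 2 * fst u * exp (2 * fst y) * (snd v \<bullet> snd w), 0)"
proof -
  have "((\<lambda>x::real \<times> (real ^ 'k). christoffel c x v w) has_derivative
      (\<lambda>u. (- 2 * fst u * exp (2 * fst y) * (snd v \<bullet> snd w), 0))) (at y)"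
    unfolding christoffel_cusp[OF assms]
    by (auto intro!: derivative_eq_intros simp: algebra_simps)
  from frechet_derivative_at[OF this] show ?thesis by metis
qed

text \<open>This is the curvature tensor of constant sectional curvature -1 in the sign convention
  of \<open>riemann\<close>.\<close>

lemma riemann_cusp:
  fixes c :: "(_, real \<times> (real ^ 'k::finite)) rchart"
  assumes "cmet c = cusp_metric"
  shows "riemann c y u v w = cusp_metric y u w *\<^sub>R v - cusp_metric y v w *\<^sub>R u"
  unfolding riemann_def pd_christoffel_cusp[OF assms]
  unfolding christoffel_cusp[OF assms]
  by (simp add: prod_eq_iff cusp_metric_def vec_eq_iff inner_add_right inner_commute algebra_simps)

lemma sum_Basis_prod:
  fixes f :: "'a::euclidean_space \<times> 'b::euclidean_space \<Rightarrow> 'c::comm_monoid_add"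
  shows "(\<Sum>b\<in>Basis. f b) = (\<Sum>a\<in>Basis. f (a, 0)) + (\<Sum>b\<in>Basis. f (0, b))"
proof -
  have "(\<Sum>b\<in>Basis. f b) =
      (\<Sum>b\<in>(\<lambda>u. (u, 0)) ` Basis. f b) + (\<Sum>b\<in>(\<lambda>v. (0, v)) ` Basis. f b)"
    unfolding Basis_prod_def by (rule sum.union_disjoint) (auto simp: nonzero_Basis)
  also have "\<dots> = (\<Sum>a\<in>Basis. f (a, 0)) + (\<Sum>b\<in>Basis. f (0, b))"
    by (simp add: sum.reindex inj_on_def)
  finally show ?thesis .
qed

text \<open>The trace of u \<mapsto> g(u,w) v is g(v,w), while the identity has trace
  \<open>CARD('k) + 1\<close>; the difference leaves the factor \<open>- CARD('k)\<close>.\<close>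

lemma ricci_cusp:
  fixes c :: "(_, real \<times> (real ^ 'k::finite)) rchart"
  assumes "cmet c = cusp_metric"
  shows "ricci c y v w = - real CARD('k) * cusp_metric y v w"
proof -
  let ?g = "\<lambda>u. cusp_metric y u w"
  have lin: "linear ?g" by (intro linearI) (simp_all add: cusp_metric_def algebra_simps)
  have "(\<Sum>b\<in>Basis. ?g b * (v \<bullet> b)) = ?g (\<Sum>b\<in>Basis. (v \<bullet> b) *\<^sub>R b)"
    by (simp add: linear_sum[OF lin] linear_cmul[OF lin] mult.commute)
  also have "\<dots> = ?g v" by (simp add: euclidean_representation)
  finally have "ricci c y v w = ?g v - (\<Sum>b\<in>(Basis :: (real \<times> (real ^ 'k)) set). ?g v)"
    unfolding ricci_def riemann_cusp[OF assms]
    by (simp add: inner_diff_left sum_subtractf)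
  then show ?thesis by (simp add: algebra_simps)
qed

lemma Ric_cusp:
  fixes p :: "real \<times> (complex ^ 'k::finite)"
  assumes "p \<in> cyl"
  shows "Ric cusp p = - real CARD('k)"
proof -
  have "cmet (chart_at cusp p) = cusp_metric"
    using chart_at_cusp(1)[OF assms] cusp_chart_atlas by metis
  \<comment> \<open>The unit vector \<open>(1, 0)\<close> shows that the set is not empty, so the
    infimum is taken over a singleton.\<close>
  then have "{ricci (chart_at cusp p) y v v | v. cmet (chart_at cusp p) y v v = 1}
      = {- real CARD('k)}" for y
    by (auto simp: ricci_cusp) (auto simp: cusp_metric_def intro!: exI[of _ "1 :: real"] exI[of _ "0 :: real ^ 'k"])
  then show ?thesis by (simp add: Ric_def Let_def)
qed

section \<open>Gradient, Laplacian and the positive supersolution\<close>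

lemma grad_in_cusp:
  fixes c :: "(_, real \<times> (real ^ 'k::finite)) rchart"
  assumes "cmet c = cusp_metric" and "f differentiable (at y)"
  shows "grad_in c f y = (pd f y (1, 0), exp (- 2 * fst y) *\<^sub>R (\<Sum>b\<in>Basis. pd f y (0, b) *\<^sub>R b))"
    (is "_ = ?X")
  unfolding grad_in_def assms
proof (rule the_equality)
  have lin: "linear (pd f y)" using assms(2) by (simp add: linear_frechet_derivative)
  have "cusp_metric y ?X v = pd f y v" for v :: "real \<times> (real ^ 'k)"
  proof -
    have "v = fst v *\<^sub>R (1, 0) + (\<Sum>b\<in>Basis. (snd v \<bullet> b) *\<^sub>R (0, b))"
      by (simp add: prod_eq_iff fst_sum snd_sum euclidean_representation)
    then have "pd f y v = pd f y (fst v *\<^sub>R (1, 0) + (\<Sum>b\<in>Basis. (snd v \<bullet> b) *\<^sub>R (0, b)))" by simp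
    also have "\<dots> = fst v * pd f y (1, 0) + (\<Sum>b\<in>Basis. (snd v \<bullet> b) * pd f y (0, b))"
      by (simp only: linear_add[OF lin] linear_cmul[OF lin] linear_sum[OF lin] real_scaleR_def)
    also have "(\<Sum>b\<in>Basis. (snd v \<bullet> b) * pd f y (0, b)) = (\<Sum>b\<in>Basis. pd f y (0, b) *\<^sub>R b) \<bullet> snd v"
      by (simp add: inner_sum_left inner_commute[of "snd v"] mult.commute)
    finally have "pd f y v = fst v * pd f y (1, 0) + (\<Sum>b\<in>Basis. pd f y (0, b) *\<^sub>R b) \<bullet> snd v" .
    moreover have "exp (2 * fst y) * exp (- 2 * fst y) = 1" by (simp flip: exp_add)
    ultimately show ?thesis
      by (simp add: cusp_metric_def flip: mult.assoc)
  qed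
  then show *: "\<forall>v. cusp_metric y ?X v = pd f y v" by blast
  show "X = ?X" if "\<forall>v. cusp_metric y X v = pd f y v" for X
    by (rule cusp_metric_nondegenerate[of y]) (simp only: spec[OF that] spec[OF *])
qed

text \<open>Discarding the torus components of the gradient reduces the quadratic form to
  one-dimensional integrals in t.\<close>

lemma grad_norm_sq_cusp_ge:
  fixes p :: "real \<times> (complex ^ 'k::finite)"
  assumes "p = cyl_par y" and f: "(f \<circ> cyl_par) differentiable (at (coord (chart_at cusp p) p))"
  shows "(pd (f \<circ> cyl_par) (coord (chart_at cusp p) p) (1, 0))\<^sup>2 \<le> grad_norm_sq cusp f p"
proof -
  let ?c = "chart_at cusp p"
  have "p \<in> cyl" using assms(1) cyl_par_in_cyl by blast
  then have c: "?c \<in> atlas cusp" "p \<in> cimage ?c" using chart_at_cusp[of p] by auto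
  then have "cpar ?c = cyl_par" "cmet ?c = cusp_metric" using cusp_chart_atlas by metis+
  then show ?thesis
    using grad_in_cusp[OF _ f, of ?c]
    by (simp add: grad_norm_sq_def Let_def) (simp add: cusp_metric_def power2_eq_square)
qed

lemma exp_fst_cyl_par: "(\<lambda>p. exp (a * fst p)) \<circ> cyl_par = (\<lambda>y. exp (a * fst y))"
  by (simp add: fun_eq_iff)

text \<open>The term a^2 is the second derivative in t; each torus direction adds a through its
  Christoffel symbol, since the gradient points along t. The factor is smallest at a = -m/2 with m =
  \<open>CARD('k)\<close>, which is the exponent chosen for the supersolution.\<close>

lemma laplacian_cusp_exp:
  fixes p :: "real \<times> (complex ^ 'k::finite)"
  assumes "p \<in> cyl"
  shows "laplacian cusp (\<lambda>p. exp (a * fst p)) p = (a\<^sup>2 + real CARD('k) * a) * exp (a * fst p)"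
proof -
  let ?c = "chart_at cusp p"
  let ?y = "coord ?c p"
  let ?f = "\<lambda>y :: real \<times> (real ^ 'k). exp (a * fst y)"
  have c: "cpar ?c = cyl_par" "cmet ?c = cusp_metric"
    using chart_at_cusp(1)[OF assms] cusp_chart_atlas by metis+
  have "fst ?y = fst p"
    using coord_in_cdom(2)[OF chart_at_cusp(2)[OF assms]] c by (metis fst_cyl_par)
  have pdf: "pd ?f y v = a * fst v * exp (a * fst y)" for y v
    using pd_exp_fst[of 1 a 0 y v] by simp
  have "?f differentiable (at y)" for y
    using differentiableI[OF has_derivative_exp_fst[of 1 a 0 y]] by simp
  then have "grad_in ?c ?f y = (a * exp (a * fst y), 0)" for y
    by (subst grad_in_cusp[OF c(2)]) (auto simp: pdf)
  then have grad: "grad_in ?c ?f = (\<lambda>y. (a * exp (a * fst y), 0))" by blast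
  have "((\<lambda>y :: real \<times> (real ^ 'k). (a * exp (a * fst y), 0 :: real ^ 'k)) has_derivative
      (\<lambda>v. (a * a * fst v * exp (a * fst y), 0))) (at y)" for y
    by (auto intro!: derivative_eq_intros)
  from frechet_derivative_at[OF this]
  have pdX: "pd (\<lambda>y :: real \<times> (real ^ 'k). (a * exp (a * fst y), 0 :: real ^ 'k)) y v
      = (a * a * fst v * exp (a * fst y), 0)" for y v
    by metis
  have "div_in ?c (grad_in ?c ?f) ?y
      = a * a * exp (a * fst ?y) + (\<Sum>b\<in>(Basis :: (real ^ 'k) set). a * exp (a * fst ?y))"
    unfolding div_in_def grad pdX christoffel_cusp[OF c(2)]
    by (subst sum_Basis_prod) (simp add: inner_Basis)
  then show ?thesis
    using \<open>fst ?y = fst p\<close>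
    by (simp add: laplacian_def Let_def c exp_fst_cyl_par power2_eq_square algebra_simps)
qed

text \<open>The function is locally Lipschitz, and in a ball of radius 1/2 distances are at most 1,
  hence bounded by their square roots.\<close>

lemma exp_locally_Hoelder:
  "locally_Hoelder_on (1/2) (\<lambda>y :: real \<times> 'e::euclidean_space. K * exp (a * fst y)) S"
  unfolding locally_Hoelder_on_def
proof
  fix y :: "real \<times> 'e" assume "y \<in> S"
  let ?B = "exp (\<bar>a\<bar> * (\<bar>fst y\<bar> + 1))"
  let ?C = "\<bar>K\<bar> * \<bar>a\<bar> * ?B"
  have lip: "\<bar>exp s - exp t\<bar> \<le> exp b * \<bar>s - t\<bar>" if "s \<le> b" "t \<le> b" for s t b :: real
  proof -
    have *: "exp s - exp t \<le> exp s * (s - t)" for s t :: real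
    proof -
      have "1 + (t - s) \<le> exp (t - s)" by (rule exp_ge_add_one_self)
      then have "exp s * (1 + (t - s)) \<le> exp s * exp (t - s)" by (intro mult_left_mono) auto
      also have "\<dots> = exp t" by (simp flip: exp_add)
      finally show ?thesis by (simp add: algebra_simps)
    qed
    have **: "exp s - exp t \<le> exp b * (s - t)" if "t \<le> s" "s \<le> b" for s t
      using *[of s t] that by (smt (verit) exp_le_cancel_iff mult_right_mono)
    show ?thesis
      using **[of s t] **[of t s] that by (cases "t \<le> s") (auto simp: abs_if)
  qed
  show "\<exists>r>0. \<exists>C. \<forall>x\<in>ball y r \<inter> S. \<forall>z\<in>ball y r \<inter> S.
      \<bar>K * exp (a * fst x) - K * exp (a * fst z)\<bar> \<le> C * dist x z powr (1/2)"
  proof (rule exI[of _ "1/2"], intro conjI, simp, rule exI[of _ ?C], intro ballI)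
    fix x z assume x: "x \<in> ball y (1/2) \<inter> S" and z: "z \<in> ball y (1/2) \<inter> S"
    have fd: "\<bar>fst p - fst q\<bar> \<le> dist p q" for p q :: "real \<times> 'e"
      using dist_fst_le[of p q] by (simp add: dist_real_def)
    have "dist x z \<le> 1" using x z by (auto intro: order_trans[OF dist_triangle2[of x z y]] simp: dist_commute)
    have ub: "a * fst q \<le> \<bar>a\<bar> * (\<bar>fst y\<bar> + 1)" if "dist y q < 1/2" for q
    proof -
      have "\<bar>fst q\<bar> \<le> \<bar>fst y\<bar> + 1" using fd[of y q] that by linarith
      then have "\<bar>a\<bar> * \<bar>fst q\<bar> \<le> \<bar>a\<bar> * (\<bar>fst y\<bar> + 1)" by (intro mult_left_mono) auto
      then show ?thesis by (metis abs_ge_self abs_mult order_trans)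
    qed
    have "\<bar>exp (a * fst x) - exp (a * fst z)\<bar> \<le> ?B * \<bar>a * fst x - a * fst z\<bar>"
      using x z by (intro lip ub) auto
    then have "\<bar>K\<bar> * \<bar>exp (a * fst x) - exp (a * fst z)\<bar> \<le> \<bar>K\<bar> * (?B * \<bar>a * fst x - a * fst z\<bar>)"
      by (intro mult_left_mono) auto
    then have "\<bar>K * exp (a * fst x) - K * exp (a * fst z)\<bar> \<le> ?C * \<bar>fst x - fst z\<bar>"
      by (simp add: abs_mult mult_ac flip: right_diff_distrib)
    also have "\<dots> \<le> ?C * dist x z" by (intro mult_left_mono fd) auto
    also have "\<dots> \<le> ?C * dist x z powr (1/2)"
    proof (intro mult_left_mono)
      show "dist x z \<le> dist x z powr (1/2)"
        using \<open>dist x z \<le> 1\<close> powr_mono'[of "1/2" 1 "dist x z"] by simp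
    qed auto
    finally show "\<bar>K * exp (a * fst x) - K * exp (a * fst z)\<bar> \<le> ?C * dist x z powr (1/2)" .
  qed
qed

text \<open>The positive supersolution is \<open>e\<^sup>a\<^sup>t\<close> with \<open>a = -(n-1)/2\<close>, for which
  \<open>\<Delta> u = -((n-1)/2)\<^sup>2 u\<close>.\<close>

lemma lambda1_nonneg_supersolution_cusp:
  assumes "\<gamma> \<ge> 4 / real CARD('k)"
  shows "lambda1_nonneg_supersolution \<gamma> (cusp :: (_, real \<times> (real ^ 'k::finite)) rmfd)"
  unfolding lambda1_nonneg_supersolution_def
proof (intro exI[of _ "1/2"] exI conjI ballI)
  let ?m = "real CARD('k)"
  let ?a = "- (?m / 2)"
  let ?u = "\<lambda>p :: real \<times> (complex ^ 'k). exp (?a * fst p)"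
  have c: "?u \<circ> cpar c = (\<lambda>y. exp (?a * fst y))" if "c \<in> atlas cusp"
    for c :: "(_, real \<times> (real ^ 'k)) rchart"
    using that cusp_chart_atlas exp_fst_cyl_par by metis
  have Ck: "Ck_on k (\<lambda>y :: real \<times> (real ^ 'k). exp (?a * fst y)) S" for k S
    using Ck_on_exp_fst[of k 1 ?a 0 S] by simp
  have pd1: "pd (\<lambda>y :: real \<times> (real ^ 'k). exp (?a * fst y)) x i = (?a * fst i) * exp (?a * fst x)"
    for x i using pd_exp_fst[of 1 ?a 0 x i] by simp
  have pd2: "pd (\<lambda>y :: real \<times> (real ^ 'k). K * exp (?a * fst y)) x i = (K * ?a * fst i) * exp (?a * fst x)"
    for x i K using pd_exp_fst[of K ?a 0 x i] by simp
  show "C2_Hoelder_fun (1/2) cusp ?u"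
    unfolding C2_Hoelder_fun_def Ck_fun_def
  proof (intro conjI ballI)
    fix c :: "(_, real \<times> (real ^ 'k)) rchart" assume "c \<in> atlas cusp"
    show "Ck_on 2 (?u \<circ> cpar c) (cdom c)" unfolding c[OF \<open>c \<in> atlas cusp\<close>] by (rule Ck)
    show "locally_Hoelder_on (1/2) (\<lambda>y. pd (\<lambda>x. pd (?u \<circ> cpar c) x i) y j) (cdom c)" for i j
      unfolding c[OF \<open>c \<in> atlas cusp\<close>] pd1 pd2 by (rule exp_locally_Hoelder)
  qed
  fix p :: "real \<times> (complex ^ 'k)" assume "p \<in> topspace (mtop cusp)"
  then have p: "p \<in> cyl" by (simp add: mtop_cusp)
  have "?m \<le> \<gamma> * (?m / 2)\<^sup>2" using assms by (simp add: power2_eq_square field_simps)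
  then have "0 \<le> (\<gamma> * (?m / 2)\<^sup>2 - ?m) * ?u p" by (intro mult_nonneg_nonneg) auto
  also have "\<dots> = - \<gamma> * laplacian cusp ?u p + Ric cusp p * ?u p"
    unfolding laplacian_cusp_exp[OF p] Ric_cusp[OF p] by (simp add: power2_eq_square field_simps)
  finally show "0 \<le> - \<gamma> * laplacian cusp ?u p + Ric cusp p * ?u p" .
qed auto

subsection \<open>The volume measure\<close>

text \<open>A permutation other than the identity moves some basis vector, so its term in the
  Leibniz sum contains an off-diagonal factor 0.\<close>

lemma gram_det_diagonal:
  fixes g :: "'e::euclidean_space \<Rightarrow> 'e \<Rightarrow> real"
  assumes "\<And>b b'. b \<in> Basis \<Longrightarrow> b' \<in> Basis \<Longrightarrow> b \<noteq> b' \<Longrightarrow> g b b' = 0"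
  shows "gram_det g = (\<Prod>b\<in>Basis. g b b)"
proof -
  have "(\<Prod>b\<in>Basis. g b (\<pi> b)) = 0" if \<pi>: "\<pi> permutes Basis" "\<pi> \<noteq> id" for \<pi>
  proof -
    obtain b where b: "\<pi> b \<noteq> b" using \<pi>(2) by (auto simp: fun_eq_iff)
    then have "b \<in> Basis" using \<pi>(1) permutes_not_in by metis
    moreover have "\<pi> b \<in> Basis" using \<pi>(1) calculation permutes_in_image by metis
    ultimately show ?thesis using assms b by (metis finite_Basis prod_zero)
  qed
  then have "gram_det g = (\<Sum>\<pi>\<in>{id}. of_int (sign \<pi>) * (\<Prod>b\<in>Basis. g b (\<pi> b)))"
    unfolding gram_det_def
    by (intro sum.mono_neutral_right finite_permutations) (auto simp: permutes_id)
  then show ?thesis by (simp add: sign_id)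
qed

definition cusp_density :: "real \<times> (real ^ 'k::finite) \<Rightarrow> real" where
  "cusp_density y = exp (real CARD('k) * fst y)"

lemma sqrt_gram_det_cusp:
  "sqrt (gram_det (cusp_metric y)) = cusp_density (y :: real \<times> (real ^ 'k::finite))"
proof -
  let ?f = "\<lambda>b :: real \<times> (real ^ 'k). cusp_metric y b b"
  have "gram_det (cusp_metric y) = (\<Prod>b\<in>Basis. ?f b)"
    by (rule gram_det_diagonal) (auto simp: cusp_metric_def Basis_prod_def inner_Basis split: if_splits)
  also have "\<dots> = (\<Prod>b\<in>(\<lambda>u. (u, 0)) ` Basis. ?f b) * (\<Prod>b\<in>(\<lambda>v. (0, v)) ` Basis. ?f b)"
    unfolding Basis_prod_def by (rule prod.union_disjoint) (auto simp: nonzero_Basis)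
  also have "\<dots> = exp (2 * fst y) ^ CARD('k)"
    by (simp add: prod.reindex inj_on_def cusp_metric_def)
  also have "\<dots> = (cusp_density y)\<^sup>2"
    by (simp add: cusp_density_def power2_eq_square mult_exp_exp flip: exp_of_nat_mult)
  finally show ?thesis by (simp add: cusp_density_def)
qed

section \<open>Uniqueness of the volume measure\<close>

abbreviation cyl_sigma :: "(real \<times> (complex ^ 'k)) measure" where
  "cyl_sigma \<equiv> sigma cyl {U. openin (top_of_set cyl) U}"

lemma opens_cyl: "{U. openin (top_of_set cyl) U} \<subseteq> Pow cyl"
  using openin_imp_subset by blast

lemma sets_cyl_sigma: "sets cyl_sigma = sigma_sets cyl {U. openin (top_of_set cyl) U}"
  and space_cyl_sigma: "space cyl_sigma = cyl"
  by (rule sets_measure_of[OF opens_cyl], rule space_measure_of[OF opens_cyl])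

lemma measurable_cyl_par:
  "(cyl_par :: real \<times> (real ^ 'k::finite) \<Rightarrow> _) \<in> measurable borel cyl_sigma"
proof (rule measurable_measure_of[OF opens_cyl])
  show "cyl_par \<in> space borel \<rightarrow> (cyl :: (real \<times> (complex ^ 'k)) set)" using cyl_par_in_cyl by auto
  fix U :: "(real \<times> (complex ^ 'k)) set" assume "U \<in> {U. openin (top_of_set cyl) U}"
  then obtain O' where "open O'" "U = cyl \<inter> O'" by (auto simp: openin_open)
  moreover have "cyl_par -` U = cyl_par -` O'" using calculation cyl_par_in_cyl by auto
  ultimately have "open (cyl_par -` U)" using continuous_on_cyl_par by (metis open_vimage)
  then show "cyl_par -` U \<inter> space borel \<in> sets borel" by simp
qed

text \<open>Induction over the Borel sets, applied to their traces on \<open>D\<close>: open sets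
  have open images, and injectivity on \<open>D\<close> makes the image commute with complements
  relative to \<open>D\<close>.\<close>

lemma cyl_par_image_sets:
  fixes B :: "(real \<times> (real ^ 'k::finite)) set"
  assumes D: "open D" "inj_on cyl_par D" and B: "B \<in> sets borel" "B \<subseteq> D"
  shows "cyl_par ` B \<in> sets cyl_sigma"
proof -
  have op: "cyl_par ` U \<in> sets cyl_sigma" if "open U" for U :: "(real \<times> (real ^ 'k)) set"
    unfolding sets_cyl_sigma using openin_cyl_par_image[OF that] by (auto intro: sigma_sets.Basic)
  have "B \<in> sigma_sets UNIV {S. open S}" using B by (simp add: borel_def)
  then have "cyl_par ` (B \<inter> D) \<in> sets cyl_sigma"
  proof induction
    case (Basic a)
    then show ?case using D op by auto
  next
    case (Compl a)
    have "cyl_par ` ((UNIV - a) \<inter> D) = cyl_par ` D - cyl_par ` (a \<inter> D)"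
      using D(2) by (auto simp: inj_on_def)
    then show ?case using Compl op[OF D(1)] by auto
  next
    case (Union a)
    have "cyl_par ` (\<Union> (range a) \<inter> D) = (\<Union>i. cyl_par ` (a i \<inter> D))" by auto
    then show ?case using Union by auto
  qed simp
  then show ?thesis using B(2) by (simp add: Int_absorb2)
qed

text \<open>By the Lindelof property countably many charts cover the cusp. A measurable set is cut
  into countably many disjoint pieces, each inside one chart, and there the chart formula prescribes
  the value.\<close>

lemma is_volume_measure_unique:
  fixes \<mu> \<nu> :: "(real \<times> (complex ^ 'k::finite)) measure"
  assumes "is_volume_measure cusp \<mu>" "is_volume_measure cusp \<nu>"
  shows "\<mu> = \<nu>"
proof (rule measure_eqI)
  have sets: "sets \<mu> = sets cyl_sigma" "sets \<nu> = sets cyl_sigma"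
    using assms by (simp_all add: is_volume_measure_def mtop_cusp sets_cyl_sigma)
  then show "sets \<mu> = sets \<nu>" by simp
  obtain \<F>' where \<F>': "\<F>' \<subseteq> cimage ` atlas (cusp :: (_, real \<times> (real ^ 'k)) rmfd)" "countable \<F>'"
    "\<Union>\<F>' = \<Union>(cimage ` atlas (cusp :: (_, real \<times> (real ^ 'k)) rmfd))"
    using Lindelof_openin[of "cimage ` atlas (cusp :: (_, real \<times> (real ^ 'k)) rmfd)" cyl]
      openin_cimage_cusp by blast
  then have cov: "\<Union>\<F>' = cyl" using topspace_cusp[where 'k = 'k] by simp
  then have "\<F>' \<noteq> {}" using cyl_par_in_cyl by auto
  then have "from_nat_into \<F>' n \<in> cimage ` atlas (cusp :: (_, real \<times> (real ^ 'k)) rmfd)" for n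
    by (rule subsetD[OF \<F>'(1) from_nat_into])
  then have "\<forall>n. \<exists>c\<in>atlas (cusp :: (_, real \<times> (real ^ 'k)) rmfd). from_nat_into \<F>' n = cimage c"
    by blast
  then obtain c where c: "\<And>n. c n \<in> atlas (cusp :: (_, real \<times> (real ^ 'k)) rmfd)"
    "\<And>n. from_nat_into \<F>' n = cimage (c n)" by metis
  have cov: "(\<Union>n. cimage (c n)) = cyl"
    using range_from_nat_into[OF \<open>\<F>' \<noteq> {}\<close> \<F>'(2)] cov c(2) by (metis image_cong)
  have cp: "cpar (c n) = cyl_par" "open (cdom (c n))" for n using cusp_chart_atlas[OF c(1)] by metis+
  fix A assume "A \<in> sets \<mu>"
  then have A: "A \<in> sets cyl_sigma" using sets by simp
  define D where "D = (\<lambda>n. A \<inter> disjointed (\<lambda>n. cimage (c n)) n)"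
  have im: "cimage (c n) \<in> sets cyl_sigma" for n
    unfolding sets_cyl_sigma using openin_cimage_cusp[OF c(1)] by (auto intro: sigma_sets.Basic)
  then have D: "D n \<in> sets cyl_sigma" for n
    unfolding D_def using A sets.range_disjointed_sets[of "\<lambda>n. cimage (c n)" cyl_sigma] by auto
  have dis: "disjoint_family D"
    unfolding D_def using disjoint_family_disjointed[of "\<lambda>n. cimage (c n)"]
    by (auto simp: disjoint_family_on_def)
  have un: "(\<Union>n. D n) = A"
    using sets.sets_into_space[OF A] cov UN_disjointed_eq[of "\<lambda>n. cimage (c n)"]
    unfolding D_def space_cyl_sigma by (simp only: UN_extend_simps) auto
  have "emeasure \<mu> (D n) = emeasure \<nu> (D n)" for n
  proof -
    define B where "B = cyl_par -` D n \<inter> cdom (c n)"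
    have "B \<in> sets borel"
      unfolding B_def using measurable_sets[OF measurable_cyl_par D] cp(2) by auto
    moreover have "D n \<subseteq> cimage (c n)" using disjointed_subset by (fastforce simp: D_def)
    then have "D n = cpar (c n) ` B" by (auto simp: B_def cimage_def cp)
    moreover have "B \<subseteq> cdom (c n)" by (simp add: B_def)
    ultimately have "\<rho> (D n) = (\<integral>\<^sup>+y\<in>B. ennreal (sqrt (gram_det (cmet (c n) y))) \<partial>lborel)"
      if "\<rho> = emeasure \<mu> \<or> \<rho> = emeasure \<nu>" for \<rho>
      using that assms c(1)[of n] unfolding is_volume_measure_def by auto
    then show ?thesis by metis
  qed
  then have "(\<Sum>n. emeasure \<mu> (D n)) = (\<Sum>n. emeasure \<nu> (D n))" by simp
  moreover have "range D \<subseteq> sets cyl_sigma" using D by blast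
  ultimately show "emeasure \<mu> A = emeasure \<nu> A"
    using suminf_emeasure[of D \<mu>] suminf_emeasure[of D \<nu>] dis sets unfolding un by simp
qed

section \<open>The volume as a pushforward from a fundamental cell\<close>

definition box_cell :: "(real \<times> (real ^ 'k::finite)) set" where
  "box_cell = UNIV \<times> {x. \<forall>i. 0 \<le> x $ i \<and> x $ i < 2 * pi}"

definition cover_measure :: "(real \<times> (real ^ 'k::finite)) measure" where
  "cover_measure = density lborel (\<lambda>y. ennreal (cusp_density y))"

text \<open>The half-open cell meets every fibre of the covering exactly once, so no part of the
  cusp is counted twice.\<close>

definition cusp_volume :: "(real \<times> (complex ^ 'k::finite)) measure" where
  "cusp_volume = distr (density cover_measure (indicator box_cell)) cyl_sigma cyl_par"

definition lattice_vector :: "int ^ 'k \<Rightarrow> real \<times> (real ^ 'k::finite)" where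
  "lattice_vector k = (0, (2 * pi) *\<^sub>R (\<chi> i. of_int (k $ i)))"

lemma cyl_par_eq_iff: "cyl_par x = cyl_par y \<longleftrightarrow> (\<exists>k. x = y + lattice_vector k)"
  by (auto simp: prod_eq_iff lattice_vector_def torus_proj_eq_iff)

lemma cyl_par_lattice [simp]: "cyl_par (y + lattice_vector k) = cyl_par y"
  using cyl_par_eq_iff by blast

lemma borel_measurable_cusp_density [measurable]: "cusp_density \<in> borel_measurable borel"
  unfolding cusp_density_def by (intro borel_measurable_continuous_onI continuous_intros)

lemma sets_cover_measure [simp]: "sets cover_measure = sets borel"
  by (simp add: cover_measure_def)

lemma sets_box_cell [measurable]: "(box_cell :: (real \<times> (real ^ 'k::finite)) set) \<in> sets borel"
proof -
  have eq: "box_cell = (\<Inter>i. {y :: real \<times> (real ^ 'k). 0 \<le> snd y $ i} \<inter> {y. snd y $ i < 2 * pi})"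
    by (auto simp: box_cell_def)
  moreover have "{y :: real \<times> (real ^ 'k). 0 \<le> snd y $ i} \<in> sets borel" for i
    by (intro borel_closed closed_Collect_le continuous_intros)
  moreover have "{y :: real \<times> (real ^ 'k). snd y $ i < 2 * pi} \<in> sets borel" for i
    by (intro borel_open open_Collect_less continuous_intros)
  ultimately show ?thesis unfolding eq by (intro sets.finite_INT sets.Int) auto
qed

lemma borel_translate:
  fixes A :: "'e::euclidean_space set"
  assumes "A \<in> sets borel"
  shows "(\<lambda>y. y + a) -` A \<in> sets borel"
  using measurable_sets[of "\<lambda>y. y + a" borel borel A] assms by simp

text \<open>Lattice vectors have no component along t, and the density depends on t only.\<close>

lemma emeasure_cover_measure_lattice:
  assumes "B \<in> sets borel"
  shows "emeasure cover_measure ((\<lambda>y. y + lattice_vector k) -` B) = emeasure cover_measure B"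
proof -
  let ?f = "\<lambda>y. ennreal (cusp_density y) * indicator B y"
  have "(\<integral>\<^sup>+y. ?f y \<partial>lborel) = (\<integral>\<^sup>+y. ?f y \<partial>distr lborel borel ((+) (lattice_vector k)))"
    by (simp only: lborel_distr_plus)
  also have "\<dots> = (\<integral>\<^sup>+y. ?f (lattice_vector k + y) \<partial>lborel)"
    using assms by (subst nn_integral_distr) auto
  also have "\<dots> = (\<integral>\<^sup>+y. ennreal (cusp_density y) * indicator ((\<lambda>y. y + lattice_vector k) -` B) y \<partial>lborel)"
    by (intro nn_integral_cong) (auto simp: cusp_density_def lattice_vector_def add.commute indicator_def)
  finally show ?thesis
    using assms borel_translate[OF assms, of "lattice_vector k"] by (simp add: cover_measure_def emeasure_density)
qed

lemma box_cell_tiling: "\<exists>!k. y + lattice_vector k \<in> box_cell"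
proof -
  have *: "0 \<le> x + 2 * pi * of_int j \<and> x + 2 * pi * of_int j < 2 * pi \<longleftrightarrow> j = - \<lfloor>x / (2 * pi)\<rfloor>"
    for x :: real and j :: int
  proof -
    have e: "(of_int (- j) + 1) * (2 * pi) = 2 * pi - 2 * pi * real_of_int j"
      "of_int (- j) * (2 * pi) = - (2 * pi * real_of_int j)" by (simp_all add: algebra_simps)
    have "of_int (- j) \<le> x / (2 * pi) \<longleftrightarrow> of_int (- j) * (2 * pi) \<le> x"
      by (rule pos_le_divide_eq) simp
    then have lower: "0 \<le> x + 2 * pi * of_int j \<longleftrightarrow> of_int (- j) \<le> x / (2 * pi)"
      unfolding e by linarith
    have "x / (2 * pi) < of_int (- j) + 1 \<longleftrightarrow> x < (of_int (- j) + 1) * (2 * pi)"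
      by (rule pos_divide_less_eq) simp
    then have upper: "x + 2 * pi * of_int j < 2 * pi \<longleftrightarrow> x / (2 * pi) < of_int (- j) + 1"
      unfolding e by linarith
    have "j = - \<lfloor>x / (2 * pi)\<rfloor> \<longleftrightarrow> \<lfloor>x / (2 * pi)\<rfloor> = - j" by auto
    then show ?thesis unfolding lower upper floor_eq_iff by simp
  qed
  have "y + lattice_vector k \<in> box_cell \<longleftrightarrow> (\<forall>i. k $ i = - \<lfloor>snd y $ i / (2 * pi)\<rfloor>)" for k
    unfolding *[symmetric] by (cases y) (simp add: box_cell_def lattice_vector_def)
  then show ?thesis
    by (intro ex1I[of _ "\<chi> i. - \<lfloor>snd y $ i / (2 * pi)\<rfloor>"]) (auto simp: vec_eq_iff)
qed

text \<open>The part of the fibre over \<open>cyl_par ` B\<close> in the fundamental cell is cut into pieces of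
  lattice translates of \<open>B\<close>; translating them back gives a partition of \<open>B\<close>.\<close>

lemma emeasure_fundamental_cell:
  fixes B :: "(real \<times> (real ^ 'k::finite)) set"
  assumes B: "B \<in> sets borel" and inj: "inj_on cyl_par B"
  shows "emeasure cover_measure (box_cell \<inter> cyl_par -` (cyl_par ` B)) = emeasure cover_measure B"
proof -
  define P where "P = (\<lambda>k :: int ^ 'k. box_cell \<inter> (\<lambda>y. y + lattice_vector k) -` B)"
  define R where "R = (\<lambda>k :: int ^ 'k. (\<lambda>y. y + lattice_vector (- k)) -` (box_cell :: (real \<times> (real ^ 'k)) set) \<inter> B)"
  have lm: "lattice_vector (- k) = - lattice_vector k" for k :: "int ^ 'k"
    by (simp add: lattice_vector_def vec_eq_iff)
  have "P k \<in> sets cover_measure" "R k \<in> sets cover_measure" for k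
    using borel_translate B by (auto simp: P_def R_def)
  note meas = this
  have PR: "emeasure cover_measure (P k) = emeasure cover_measure (R k)" for k
  proof -
    have "y \<in> P k \<longleftrightarrow> y + lattice_vector k \<in> R k" for y by (simp add: P_def R_def lm)
    then have "P k = (\<lambda>y. y + lattice_vector k) -` R k" by blast
    then show ?thesis using emeasure_cover_measure_lattice[of "R k" k] meas by simp
  qed
  \<comment> \<open>Two translates of one point that both lie in \<open>B\<close> coincide because
    \<open>cyl_par\<close> is injective on \<open>B\<close>. For \<open>R\<close>, disjointness
    comes instead from the uniqueness in \<open>box_cell_tiling\<close>.\<close>
  have "disjoint_family P"
  proof (clarsimp simp: disjoint_family_on_def)
    fix k l :: "int ^ 'k" assume "k \<noteq> l"
    have False if y: "y \<in> P k" "y \<in> P l" for y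
    proof -
      have "y + lattice_vector k \<in> B" "y + lattice_vector l \<in> B" using y by (auto simp: P_def)
      then have "y + lattice_vector k = y + lattice_vector l" by (intro inj_onD[OF inj]) auto
      then show False using \<open>k \<noteq> l\<close> by (auto simp: lattice_vector_def vec_eq_iff)
    qed
    then show "P k \<inter> P l = {}" by blast
  qed
  have "disjoint_family R"
  proof (clarsimp simp: disjoint_family_on_def)
    fix k l :: "int ^ 'k" assume "k \<noteq> l"
    have False if y: "y \<in> R k" "y \<in> R l" for y
    proof -
      have "y + lattice_vector (- k) \<in> box_cell" "y + lattice_vector (- l) \<in> box_cell" using y by (auto simp: R_def)
      then have "- k = - l" using box_cell_tiling[of y] by blast
      then show False using \<open>k \<noteq> l\<close> by simp
    qed
    then show "R k \<inter> R l = {}" by blast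
  qed
  have UP: "\<Union>(range P) = box_cell \<inter> cyl_par -` (cyl_par ` B)"
  proof -
    have "y \<in> cyl_par -` (cyl_par ` B) \<longleftrightarrow> (\<exists>k. y + lattice_vector k \<in> B)" for y
    proof
      assume "y \<in> cyl_par -` (cyl_par ` B)"
      then obtain b where "b \<in> B" "cyl_par b = cyl_par y" by auto
      then show "\<exists>k. y + lattice_vector k \<in> B" unfolding cyl_par_eq_iff by auto
    next
      assume "\<exists>k. y + lattice_vector k \<in> B"
      then show "y \<in> cyl_par -` (cyl_par ` B)" by (metis cyl_par_lattice image_eqI vimageI)
    qed
    then show ?thesis unfolding P_def by blast
  qed
  have UR: "\<Union>(range R) = B"
  proof -
    have "\<exists>k. y + lattice_vector (- k) \<in> box_cell" for y :: "real \<times> (real ^ 'k)"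
      using box_cell_tiling[of y] by (metis minus_minus)
    then show ?thesis unfolding R_def by blast
  qed
  have "emeasure cover_measure (\<Union>(range P)) = emeasure cover_measure (\<Union>(range R))"
    using emeasure_UN_countable[of UNIV P cover_measure] emeasure_UN_countable[of UNIV R cover_measure]
      meas PR \<open>disjoint_family P\<close> \<open>disjoint_family R\<close>
    by simp
  then show ?thesis unfolding UP UR .
qed

lemma is_volume_measure_cusp: "is_volume_measure cusp (cusp_volume :: (real \<times> (complex ^ 'k::finite)) measure)"
  unfolding is_volume_measure_def
proof (intro conjI ballI impI)
  show "space cusp_volume = topspace (mtop (cusp :: (_, real \<times> (real ^ 'k)) rmfd))"
    by (simp add: cusp_volume_def space_cyl_sigma mtop_cusp)
  show "sets cusp_volume = sigma_sets (topspace (mtop cusp)) {U. openin (mtop (cusp :: (_, real \<times> (real ^ 'k)) rmfd)) U}"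
    by (simp add: cusp_volume_def sets_cyl_sigma mtop_cusp)
  fix c :: "(_, real \<times> (real ^ 'k)) rchart" and B :: "(real \<times> (real ^ 'k)) set"
  assume c: "c \<in> atlas cusp" and B: "B \<in> sets borel" "B \<subseteq> cdom c"
  have cc: "cpar c = cyl_par" "cmet c = cusp_metric" "open (cdom c)" "inj_on cyl_par (cdom c)"
    using cusp_chart_atlas[OF c] by metis+
  have im: "cyl_par ` B \<in> sets cyl_sigma" using cyl_par_image_sets[OF cc(3,4) B] .
  have meas: "cyl_par \<in> measurable (density cover_measure (indicator box_cell)) cyl_sigma"
    using measurable_cyl_par by (simp add: measurable_def cover_measure_def space_density)
  have "emeasure cusp_volume (cpar c ` B)
      = emeasure (density cover_measure (indicator box_cell)) (cyl_par -` (cyl_par ` B))"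
    unfolding cusp_volume_def cc emeasure_distr[OF meas im]
    by (simp add: space_density cover_measure_def)
  also have "\<dots> = emeasure cover_measure (box_cell \<inter> cyl_par -` (cyl_par ` B))"
    using measurable_sets[OF measurable_cyl_par im] by (intro emeasure_restricted) auto
  also have "\<dots> = emeasure cover_measure B"
    using B cc(4) by (intro emeasure_fundamental_cell) (auto intro: inj_on_subset)
  also have "\<dots> = (\<integral>\<^sup>+y\<in>B. ennreal (sqrt (gram_det (cmet c y))) \<partial>lborel)"
    using B by (simp add: cover_measure_def emeasure_density cc sqrt_gram_det_cusp)
  finally show "emeasure cusp_volume (cpar c ` B) = (\<integral>\<^sup>+y\<in>B. ennreal (sqrt (gram_det (cmet c y))) \<partial>lborel)" .
qed

lemma volume_measure_cusp: "volume_measure cusp = (cusp_volume :: (real \<times> (complex ^ 'k::finite)) measure)"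
  unfolding volume_measure_def
  using is_volume_measure_cusp is_volume_measure_unique by (intro the_equality) blast+

subsection \<open>The quadratic form\<close>

text \<open>Fubini on the fundamental cell. The integral over t is the inner one because the Hardy
  inequality is applied for each fixed torus coordinate.\<close>

lemma integral_cusp_volume:
  fixes f :: "real \<times> (complex ^ 'k::finite) \<Rightarrow> real"
  assumes "integrable cusp_volume f"
  shows "integral\<^sup>L cusp_volume f = (\<integral>x. (\<integral>t. indicator box_cell (t, x) * (cusp_density (t, x) * f (cyl_par (t, x)))
    \<partial>lborel) \<partial>lborel)"
proof -
  let ?M = "density cover_measure (indicator box_cell) :: (real \<times> (real ^ 'k)) measure"
  let ?F = "\<lambda>y :: real \<times> (real ^ 'k). indicator box_cell y * (cusp_density y * f (cyl_par y))"
  have meas: "cyl_par \<in> measurable ?M cyl_sigma"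
    using measurable_cyl_par by (simp add: measurable_def cover_measure_def space_density)
  have f: "f \<in> borel_measurable cyl_sigma"
    using borel_measurable_integrable[OF assms] by (simp add: cusp_volume_def)
  have fp [measurable]: "(\<lambda>y. f (cyl_par y)) \<in> borel_measurable borel"
    using measurable_compose[OF measurable_cyl_par f] .
  have M: "?M = density (density lborel (\<lambda>y. ennreal (cusp_density y))) (\<lambda>y. ennreal (indicator box_cell y))"
    by (simp add: cover_measure_def ennreal_indicator[abs_def])
  have 1: "integrable ?M (\<lambda>y. f (cyl_par y))"
    using assms integrable_distr_eq[OF meas f] by (simp add: cusp_volume_def)
  have 2: "integral\<^sup>L cusp_volume f = (\<integral>y. f (cyl_par y) \<partial>?M)"
    unfolding cusp_volume_def by (rule integral_distr[OF meas f])
  have pos: "0 \<le> cusp_density y" for y :: "real \<times> (real ^ 'k)" by (simp add: cusp_density_def)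
  have "(\<integral>y. f (cyl_par y) \<partial>?M) = (\<integral>y. cusp_density y *\<^sub>R (indicator box_cell y *\<^sub>R f (cyl_par y)) \<partial>lborel)"
    unfolding M by (subst integral_density; simp add: pos)+
  then have 3: "(\<integral>y. f (cyl_par y) \<partial>?M) = integral\<^sup>L lborel ?F"
    by (simp add: mult.left_commute)
  have "integrable lborel (\<lambda>y. cusp_density y *\<^sub>R (indicator box_cell y *\<^sub>R f (cyl_par y)))"
    using 1 unfolding M by (subst (asm) integrable_density; simp add: pos)+
  then have 4: "integrable lborel ?F" by (simp add: mult.left_commute)
  then have "integrable (lborel \<Otimes>\<^sub>M lborel) (case_prod (\<lambda>t x. ?F (t, x)))"
    by (simp add: lborel_prod case_prod_unfold)
  from lborel_pair.integral_snd[OF this] show ?thesis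
    unfolding 2 3 by (simp add: lborel_prod case_prod_unfold)
qed

text \<open>With \<open>G = - 2 e\<^sup>m\<^sup>t u\<^sup>2\<close>, the integrand minus \<open>G'\<close> is at least
  \<open>(4 / m) e\<^sup>m\<^sup>t (u' + (m / 2) u)\<^sup>2\<close>.\<close>

lemma weighted_Hardy_integrand:
  fixes m \<gamma> v v' e :: real
  assumes "m > 0" "\<gamma> \<ge> 4 / m" "e \<ge> 0"
  shows "- 2 * (m * e * v\<^sup>2 + e * (2 * v * v')) \<le> e * (\<gamma> * v'\<^sup>2 - m * v\<^sup>2)"
proof -
  have "(4 / m) * v'\<^sup>2 \<le> \<gamma> * v'\<^sup>2" using assms by (intro mult_right_mono) auto
  moreover have "(4 / m) * v'\<^sup>2 - m * v\<^sup>2 = (4 / m) * (v' + m / 2 * v)\<^sup>2 - 2 * (m * v\<^sup>2 + 2 * v * v')"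
    using assms by (simp add: power2_eq_square field_simps)
  moreover have "(4 / m) * (v' + m / 2 * v)\<^sup>2 \<ge> 0" using assms by auto
  ultimately have "- 2 * (m * v\<^sup>2 + 2 * v * v') \<le> \<gamma> * v'\<^sup>2 - m * v\<^sup>2" by linarith
  then have "e * (- 2 * (m * v\<^sup>2 + 2 * v * v')) \<le> e * (\<gamma> * v'\<^sup>2 - m * v\<^sup>2)"
    using assms by (intro mult_left_mono) auto
  then show ?thesis by (simp add: algebra_simps)
qed

text \<open>The derivative \<open>g\<close> of \<open>G\<close> integrates to 0 because
  \<open>G\<close> has compact support, and it lies below \<open>F\<close>. The function
  \<open>F\<close> is only bounded from below, which leaves room for the other components of the
  gradient. A nonintegrable \<open>F\<close> has integral 0.\<close>

lemma weighted_Hardy: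
  fixes u u' F :: "real \<Rightarrow> real"
  assumes m: "m > 0" "\<gamma> \<ge> 4 / m"
    and u: "\<And>t. (u has_real_derivative u' t) (at t)" "continuous_on UNIV u'"
    and supp: "\<And>t. \<bar>t\<bar> > R \<Longrightarrow> u t = 0"
    and F: "\<And>t. exp (m * t) * (\<gamma> * (u' t)\<^sup>2 - m * (u t)\<^sup>2) \<le> F t"
  shows "0 \<le> (\<integral>t. F t \<partial>lborel)"
proof (cases "integrable lborel F")
  case True
  define G where "G = (\<lambda>t. - 2 * (exp (m * t) * (u t)\<^sup>2))"
  define g where "g = (\<lambda>t. - 2 * (m * exp (m * t) * (u t)\<^sup>2 + exp (m * t) * (2 * u t * u' t)))"
  \<comment> \<open>Strictly larger than \<open>R\<close>, so that \<open>u\<close> vanishes at the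
    endpoints as well, and positive, so that the interval is proper.\<close>
  define r where "r = \<bar>R\<bar> + 1"
  have dG: "(G has_real_derivative g t) (at t)" for t
    unfolding G_def g_def by (auto intro!: derivative_eq_intros u(1) simp: power2_eq_square algebra_simps)
  have "continuous_on UNIV u" using u(1) by (auto intro!: continuous_at_imp_continuous_on DERIV_isCont)
  then have "continuous_on UNIV g" unfolding g_def using u(2) by (intro continuous_intros)
  then have "isCont g t" for t by (simp add: continuous_on_eq_continuous_at)
  then have hb: "has_bochner_integral lborel (\<lambda>t. g t * indicator {-r..r} t) (G r - G (-r))"
    using dG by (intro has_bochner_integral_FTC_Icc_real) (auto simp: r_def)
  moreover have "g t = 0" if "t \<notin> {-r..r}" for t
    using supp[of t] that by (auto simp: g_def r_def)
  then have "(\<lambda>t. g t * indicator {-r..r} t) = g" by (auto simp: fun_eq_iff indicator_def)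
  moreover have "G r = 0" "G (-r) = 0" using supp[of r] supp[of "-r"] by (auto simp: G_def r_def)
  ultimately have "has_bochner_integral lborel g 0" by simp
  then have "integrable lborel g" "integral\<^sup>L lborel g = 0"
    by (auto simp: has_bochner_integral_iff)
  moreover have "g t \<le> F t" for t
    using weighted_Hardy_integrand[OF m, of "exp (m * t)" "u t" "u' t"] F[of t] by (simp add: g_def)
  ultimately show ?thesis using integral_mono[OF _ True, of g] by simp
next
  case False
  then show ?thesis by (simp add: not_integrable_integral_eq)
qed

section \<open>Test functions on the cover and the quadratic form of the cusp\<close>

lemma C1c_fun_support:
  fixes \<phi> :: "real \<times> (complex ^ 'k::finite) \<Rightarrow> real"
  assumes "C1c_fun cusp \<phi>"
  obtains R where "\<And>p. p \<in> cyl \<Longrightarrow> \<bar>fst p\<bar> > R \<Longrightarrow> \<phi> p = 0"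
proof -
  let ?K = "top_of_set cyl closure_of {p \<in> cyl. \<phi> p \<noteq> 0}"
  have "compactin (top_of_set cyl) ?K" using assms by (simp add: C1c_fun_def mtop_cusp)
  then have "compact ?K" by (simp add: compactin_subtopology)
  then have "bounded (fst ` ?K)"
    by (intro compact_imp_bounded compact_continuous_image continuous_intros)
  then obtain R where R: "\<And>p. p \<in> ?K \<Longrightarrow> \<bar>fst p\<bar> \<le> R" by (auto simp: bounded_real)
  have "{p \<in> cyl. \<phi> p \<noteq> 0} \<subseteq> ?K" by (intro closure_of_subset) auto
  then have "\<phi> p = 0" if "p \<in> cyl" "\<bar>fst p\<bar> > R" for p using R[of p] that by force
  then show thesis using that by blast
qed

lemma C1c_fun_cusp:
  fixes \<phi> :: "real \<times> (complex ^ 'k::finite) \<Rightarrow> real"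
  assumes "C1c_fun cusp \<phi>"
  shows "(\<phi> \<circ> cyl_par) differentiable (at y)"
    and "continuous_on UNIV (\<lambda>y. pd (\<phi> \<circ> cyl_par) y (1, 0))"
proof -
  have B: "(1, 0) \<in> (Basis :: (real \<times> (real ^ 'k)) set)" by (simp add: Basis_prod_def)
  have *: "(\<phi> \<circ> cyl_par) differentiable (at y) \<and> isCont (\<lambda>y. pd (\<phi> \<circ> cyl_par) y (1, 0)) y"
    for y :: "real \<times> (real ^ 'k)"
  proof -
    obtain c where c: "c \<in> atlas cusp" "y \<in> cdom c" using cusp_chart_exists by blast
    have cp: "cpar c = cyl_par" "open (cdom c)" using cusp_chart_atlas[OF c(1)] by metis+
    have "Ck_on (Suc 0) (\<phi> \<circ> cyl_par) (cdom c)"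
      using assms c(1) cp(1) unfolding C1c_fun_def Ck_fun_def One_nat_def by metis
    then show ?thesis using c(2) cp(2) B by (simp add: continuous_on_eq_continuous_at)
  qed
  show "(\<phi> \<circ> cyl_par) differentiable (at y)" using * by blast
  show "continuous_on UNIV (\<lambda>y. pd (\<phi> \<circ> cyl_par) y (1, 0))"
    using * by (intro continuous_at_imp_continuous_on) blast
qed

text \<open>The point \<open>y\<close> may be any lift of \<open>cyl_par (t, x)\<close>: moving
  along t commutes with the deck transformation that relates the two lifts.\<close>

lemma DERIV_cyl_par_fst:
  fixes \<phi> :: "real \<times> (complex ^ 'k::finite) \<Rightarrow> real"
  assumes "(\<phi> \<circ> cyl_par) differentiable (at y)" and y: "cyl_par y = cyl_par (t, x)"
  shows "((\<lambda>s. \<phi> (cyl_par (s, x))) has_real_derivative pd (\<phi> \<circ> cyl_par) y (1, 0)) (at t)"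
proof -
  have eq: "\<phi> (cyl_par (s, x)) = (\<phi> \<circ> cyl_par) (y + (s - t) *\<^sub>R (1, 0))" for s
  proof -
    have "(s, x) + (y - (t, x)) = y + (s - t) *\<^sub>R (1, 0)" by (simp add: prod_eq_iff)
    then show ?thesis using cyl_par_translate[OF y[symmetric], of "(s, x)"] by (simp only: comp_def)
  qed
  have "((\<phi> \<circ> cyl_par) has_derivative pd (\<phi> \<circ> cyl_par) y) (at (y + (t - t) *\<^sub>R (1, 0)))"
    using assms(1) unfolding frechet_derivative_works by (simp flip: zero_prod_def)
  moreover have "((\<lambda>s. y + (s - t) *\<^sub>R (1, 0)) has_derivative (\<lambda>h. h *\<^sub>R (1, 0))) (at t)"
    by (rule derivative_eq_intros refl | simp)+
  ultimately have "((\<lambda>s. (\<phi> \<circ> cyl_par) (y + (s - t) *\<^sub>R (1, 0))) has_derivative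
      (\<lambda>h. pd (\<phi> \<circ> cyl_par) y (h *\<^sub>R (1, 0)))) (at t)"
    by (rule has_derivative_compose[rotated])
  moreover have "pd (\<phi> \<circ> cyl_par) y (h *\<^sub>R (1, 0)) = pd (\<phi> \<circ> cyl_par) y (1, 0) * h" for h
    using linear_cmul[OF linear_frechet_derivative[OF assms(1)], of h "(1, 0)"] by (simp only: real_scaleR_def mult.commute)
  ultimately show ?thesis unfolding eq has_field_derivative_def by (simp only:)
qed

lemma lambda1_nonneg_form_cusp:
  assumes \<gamma>: "\<gamma> \<ge> 4 / real CARD('k)"
  shows "lambda1_nonneg_form \<gamma> (cusp :: (_, real \<times> (real ^ 'k::finite)) rmfd)"
  unfolding lambda1_nonneg_form_def volume_measure_cusp
proof (intro allI impI)
  fix \<phi> :: "real \<times> (complex ^ 'k) \<Rightarrow> real" assume \<phi>: "C1c_fun cusp \<phi>"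
  let ?f = "\<lambda>p. \<gamma> * grad_norm_sq cusp \<phi> p + Ric cusp p * (\<phi> p)\<^sup>2"
  let ?m = "real CARD('k)"
  note diff = C1c_fun_cusp(1)[OF \<phi>]
  obtain R where R: "\<And>p. p \<in> cyl \<Longrightarrow> \<bar>fst p\<bar> > R \<Longrightarrow> \<phi> p = 0" using C1c_fun_support[OF \<phi>] by blast
  show "0 \<le> integral\<^sup>L cusp_volume ?f"
  proof (cases "integrable cusp_volume ?f")
    case True
    have "0 \<le> (\<integral>t. indicator box_cell (t, x) * (cusp_density (t, x) * ?f (cyl_par (t, x))) \<partial>lborel)" for x
    proof (cases "(0, x) \<in> box_cell")
      case False
      then have "(t, x) \<notin> box_cell" for t by (simp add: box_cell_def)
      then show ?thesis by simp
    next
      case True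
      then have cell: "(t, x) \<in> box_cell" for t by (simp add: box_cell_def)
      define u where "u = (\<lambda>t. \<phi> (cyl_par (t, x)))"
      define u' where "u' = (\<lambda>t. pd (\<phi> \<circ> cyl_par) (t, x) (1, 0))"
      have du: "(u has_real_derivative u' t) (at t)" for t
        unfolding u_def u'_def by (rule DERIV_cyl_par_fst[OF diff refl])
      show ?thesis
      proof (rule weighted_Hardy[where u = u and u' = u' and m = ?m and \<gamma> = \<gamma> and R = R])
        show "continuous_on UNIV u'"
          unfolding u'_def by (rule continuous_on_compose2[OF C1c_fun_cusp(2)[OF \<phi>]]) (auto intro!: continuous_intros)
        show "u t = 0" if "R < \<bar>t\<bar>" for t
          using R[OF cyl_par_in_cyl, of "(t, x)"] that by (simp add: u_def)
        fix t
        let ?p = "cyl_par (t, x)"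
        let ?y = "coord (chart_at cusp ?p) ?p"
        have "cyl_par ?y = ?p"
          using chart_at_cusp[OF cyl_par_in_cyl, of "(t, x)"] coord_in_cdom(2) cusp_chart_atlas by metis
        \<comment> \<open>The chart chosen by \<open>chart_at\<close> may yield a lift
          \<open>?y\<close> other than \<open>(t, x)\<close>; uniqueness of the derivative of
          \<open>u\<close> identifies the two values.\<close>
        then have "(u has_real_derivative pd (\<phi> \<circ> cyl_par) ?y (1, 0)) (at t)"
          unfolding u_def by (intro DERIV_cyl_par_fst diff)
        then have "pd (\<phi> \<circ> cyl_par) ?y (1, 0) = u' t" using du DERIV_unique by blast
        then have "(u' t)\<^sup>2 \<le> grad_norm_sq cusp \<phi> ?p"
          using grad_norm_sq_cusp_ge[OF refl diff, of "(t, x)"] by simp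
        moreover have "0 \<le> \<gamma>" using \<gamma> by (meson divide_nonneg_nonneg of_nat_0_le_iff order_trans zero_le_numeral)
        ultimately have "\<gamma> * (u' t)\<^sup>2 - ?m * (u t)\<^sup>2 \<le> ?f ?p"
          by (simp add: Ric_cusp[OF cyl_par_in_cyl] u_def mult_left_mono)
        then show "exp (?m * t) * (\<gamma> * (u' t)\<^sup>2 - ?m * (u t)\<^sup>2)
            \<le> indicator box_cell (t, x) * (cusp_density (t, x) * ?f ?p)"
          using cell by (simp add: cusp_density_def)
      qed (use \<gamma> du in auto)
    qed
    then show ?thesis unfolding integral_cusp_volume[OF True] by (rule Bochner_Integration.integral_nonneg)
  next
    case False
    then show ?thesis by (simp add: not_integrable_integral_eq)
  qed
qed

subsection \<open>Completeness\<close>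

text \<open>The derivative is a pointwise limit of difference quotients with steps 1/(n+1), each of
  them measurable. This provides a measurable function below the speed of a curve.\<close>

lemma borel_measurable_vector_derivative_open:
  fixes f :: "real \<Rightarrow> 'a::euclidean_space"
  assumes "open O'" "continuous_on UNIV f"
    and f': "\<And>t. t \<in> O' \<Longrightarrow> (f has_vector_derivative f' t) (at t)"
  shows "(\<lambda>t. indicator O' t *\<^sub>R f' t) \<in> borel_measurable borel"
proof (rule borel_measurable_LIMSEQ_metric)
  let ?q = "\<lambda>n t. indicator O' t *\<^sub>R (real (Suc n) *\<^sub>R (f (t + 1 / real (Suc n)) - f t))"
  have [measurable]: "f \<in> borel_measurable borel" "O' \<in> sets borel"
    using assms by (auto intro: borel_measurable_continuous_onI)
  show "?q n \<in> borel_measurable borel" for n by measurable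
  fix t
  show "(\<lambda>n. ?q n t) \<longlonglongrightarrow> indicator O' t *\<^sub>R f' t"
  proof (cases "t \<in> O'")
    case True
    have "((\<lambda>h. (f (t + h) - f t) /\<^sub>R h) \<longlongrightarrow> f' t) (at 0)"
    proof -
      have *: "((\<lambda>y. (1 / \<bar>y - t\<bar>) *\<^sub>R (f y - (f t + (y - t) *\<^sub>R f' t))) \<longlongrightarrow> 0) (at t)"
        using f'[OF True] unfolding has_vector_derivative_def has_derivative_within by simp
      have "((\<lambda>y. (f y - f t) /\<^sub>R (y - t) - f' t) \<longlongrightarrow> 0) (at t)"
      proof (rule tendsto_norm_zero_cancel, rule tendsto_cong[THEN iffD2, OF _ tendsto_norm_zero[OF *]])
        have "norm ((f y - f t) /\<^sub>R (y - t) - f' t) = norm ((1 / \<bar>y - t\<bar>) *\<^sub>R (f y - (f t + (y - t) *\<^sub>R f' t)))"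
          if "y \<noteq> t" for y
        proof -
          have "(f y - f t) /\<^sub>R (y - t) - f' t = (f y - (f t + (y - t) *\<^sub>R f' t)) /\<^sub>R (y - t)"
            using that by (simp only: diff_diff_add[symmetric] scaleR_diff_right[of _ "f y - f t"]
                scaleR_scaleR left_inverse right_minus_eq scaleR_one not_False_eq_True)
          then show ?thesis by (simp add: divide_inverse)
        qed
        then show "\<forall>\<^sub>F y in at t. norm ((f y - f t) /\<^sub>R (y - t) - f' t)
            = norm ((1 / \<bar>y - t\<bar>) *\<^sub>R (f y - (f t + (y - t) *\<^sub>R f' t)))"
          by (auto simp: eventually_at intro: exI[of _ 1])
      qed
      then have "((\<lambda>y. (f y - f t) /\<^sub>R (y - t)) \<longlongrightarrow> f' t) (at t)"
        by (simp add: LIM_zero_iff)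
      then show ?thesis using LIM_offset_zero[of "\<lambda>y. (f y - f t) /\<^sub>R (y - t)" "f' t" t] by simp
    qed
    moreover have "filterlim (\<lambda>n. 1 / real (Suc n)) (at 0) sequentially"
      unfolding filterlim_at using LIMSEQ_inverse_real_of_nat by (auto simp: inverse_eq_divide)
    ultimately have "(\<lambda>n. (f (t + 1 / real (Suc n)) - f t) /\<^sub>R (1 / real (Suc n))) \<longlonglongrightarrow> f' t"
      by (rule filterlim_compose)
    then show ?thesis using True by simp
  qed simp
qed

text \<open>The bound \<open>g\<close> need not be measurable: the integral on the right is then a lower integral.\<close>

lemma norm_diff_le_nn_integral:
  fixes f :: "real \<Rightarrow> 'a::euclidean_space"
  assumes "finite S" "a \<le> b" and cont: "continuous_on {a..b} f"
    and f': "\<And>t. t \<in> {a<..<b} - S \<Longrightarrow> (f has_vector_derivative f' t) (at t)"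
    and g: "\<And>t. t \<in> {a<..<b} - S \<Longrightarrow> norm (f' t) \<le> g t"
  shows "ennreal (norm (f b - f a)) \<le> (\<integral>\<^sup>+t\<in>{a..b}. ennreal (g t) \<partial>lborel)"
proof -
  define O' where "O' = {a<..<b} - S"
  define F where "F = (\<lambda>t. indicator O' t *\<^sub>R f' t)"
  \<comment> \<open>Extension of \<open>f\<close> by its boundary values, continuous on the whole
    line as the measurability lemma requires.\<close>
  define e where "e = (\<lambda>t. f (max a (min b t)))"
  have "open O'" unfolding O'_def using \<open>finite S\<close> by (intro open_Diff finite_imp_closed) auto
  have "continuous_on UNIV e"
    unfolding e_def by (rule continuous_on_compose2[OF cont]) (use \<open>a \<le> b\<close> in \<open>auto intro!: continuous_intros\<close>)
  moreover have "(e has_vector_derivative f' t) (at t)" if "t \<in> O'" for t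
    by (rule has_vector_derivative_transform_within_open[OF f' \<open>open O'\<close> that])
      (use that in \<open>auto simp: O'_def e_def\<close>)
  ultimately have meas: "F \<in> borel_measurable borel"
    unfolding F_def using \<open>open O'\<close> by (intro borel_measurable_vector_derivative_open)
  have le: "(\<integral>\<^sup>+t. ennreal (norm (F t)) \<partial>lborel) \<le> (\<integral>\<^sup>+t\<in>{a..b}. ennreal (g t) \<partial>lborel)"
    using g by (intro nn_integral_mono) (auto simp: F_def O'_def indicator_def intro: ennreal_leI)
  show ?thesis
  proof (cases "(\<integral>\<^sup>+t. ennreal (norm (F t)) \<partial>lborel) < \<infinity>")
    case True
    then have int: "integrable lborel F" using meas by (intro integrableI_bounded) auto
    \<comment> \<open>The gauge integral satisfies the fundamental theorem with finitely many
      exceptional points; it agrees with the Lebesgue integral because \<open>F\<close> is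
      integrable in this case.\<close>
    have "(f' has_integral (f b - f a)) {a..b}"
      using assms(1,2) f' cont by (rule fundamental_theorem_of_calculus_interior_strong)
    then have "(F has_integral (f b - f a)) {a..b}"
      by (rule has_integral_spike_finite[of "S \<union> {a, b}", rotated 2])
        (use \<open>finite S\<close> in \<open>auto simp: F_def O'_def\<close>)
    then have "(F has_integral (f b - f a)) UNIV"
      by (rule has_integral_on_superset) (auto simp: F_def O'_def)
    then have "f b - f a = integral\<^sup>L lborel F"
      using has_integral_integral_lborel[OF int] has_integral_unique by blast
    then have "ennreal (norm (f b - f a)) \<le> ennreal (\<integral>t. norm (F t) \<partial>lborel)"
      by (intro ennreal_leI) simp
    also have "\<dots> = (\<integral>\<^sup>+t. ennreal (norm (F t)) \<partial>lborel)"
      using int by (intro nn_integral_eq_integral[symmetric]) auto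
    finally show ?thesis using le by (rule order_trans)
  next
    case False
    then have "(\<integral>\<^sup>+t. ennreal (norm (F t)) \<partial>lborel) = top" unfolding infinity_ennreal_def less_top[symmetric] by simp
    with le show ?thesis by (simp add: top_unique)
  qed
qed

section \<open>Speed and length of curves in the cusp\<close>

lemma has_derivative_vec_lambda:
  fixes f :: "'i::finite \<Rightarrow> 'a::real_normed_vector \<Rightarrow> 'b::real_normed_vector"
  assumes "\<And>i. (f i has_derivative f' i) F"
  shows "((\<lambda>x. \<chi> i. f i x) has_derivative (\<lambda>v. \<chi> i. f' i v)) F"
proof -
  have eq: "(\<chi> i. a i) = (\<Sum>i\<in>UNIV. axis i (a i))" for a :: "'i \<Rightarrow> 'b"
    by (simp add: vec_eq_iff axis_def)
  have norm: "norm (axis i x) = norm x" for i :: 'i and x :: 'b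
  proof -
    have "(\<lambda>j. norm (axis i x $ j)) = (\<lambda>j. if j = i then norm x else 0)"
      by (auto simp: axis_def)
    then show ?thesis by (simp add: norm_vec_def L2_set_def if_distrib[of "\<lambda>x. x\<^sup>2"] cong: if_cong)
  qed
  have "bounded_linear (axis i :: 'b \<Rightarrow> 'b ^ 'i)" for i
    by (rule bounded_linear_intro[where K = 1]) (simp_all add: norm, simp_all add: vec_eq_iff axis_def)
  then have "((\<lambda>x. axis i (f i x)) has_derivative (\<lambda>v. axis i (f' i v))) F" for i
    using assms by (rule bounded_linear.has_derivative)
  then show ?thesis unfolding eq by (rule has_derivative_sum)
qed

lemma has_derivative_cyl_par:
  "(cyl_par has_derivative (\<lambda>v. (fst v, \<chi> i. snd v $ i *\<^sub>R (\<i> * cis (snd y $ i)))))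
    (at (y :: real \<times> (real ^ 'k::finite)))"
proof -
  have "((\<lambda>y :: real \<times> (real ^ 'k). snd y $ i) has_derivative (\<lambda>v. snd v $ i)) (at y)" for i
    by (rule bounded_linear.has_derivative[OF bounded_linear_vec_nth has_derivative_snd[OF has_derivative_ident]])
  then have "((\<lambda>y :: real \<times> (real ^ 'k). \<chi> i. cis (snd y $ i)) has_derivative
      (\<lambda>v. \<chi> i. snd v $ i *\<^sub>R (\<i> * cis (snd y $ i)))) (at y)"
    by (rule has_derivative_vec_lambda[OF has_derivative_cis])
  then show ?thesis
    unfolding cyl_par_def torus_proj_def case_prod_unfold
    by (rule has_derivative_Pair[OF has_derivative_fst[OF has_derivative_ident]])
qed

text \<open>Near \<open>t\<close> the curve is \<open>cyl_par\<close> applied to its coordinates.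
  Each factor \<open>\<i> * cis _\<close> has modulus 1, so \<open>cyl_par\<close> preserves the
  norm of the torus part, and the speed is the hypotenuse over the two quantities to be
  bounded.\<close>

lemma curve_vector_derivative:
  fixes \<sigma> :: "real \<Rightarrow> real \<times> (complex ^ 'k::finite)"
  assumes cont: "continuous_on {0..1} \<sigma>" "\<sigma> ` {0..1} \<subseteq> cyl" and "finite S"
    and C1: "\<forall>c\<in>atlas cusp. (coord c \<circ> \<sigma>) C1_differentiable_on {t \<in> {0<..<1} - S. \<sigma> t \<in> cimage c}"
    and t: "t \<in> {0<..<1} - S"
  obtains D where "(\<sigma> has_vector_derivative D) (at t)" "\<bar>fst D\<bar> \<le> speed cusp \<sigma> t"
    "exp (fst (\<sigma> t)) * norm (snd D) \<le> speed cusp \<sigma> t"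
proof -
  define c where "c = chart_at cusp (\<sigma> t)"
  have "\<sigma> t \<in> cyl" using cont(2) t by (auto simp: image_subset_iff)
  then have c: "c \<in> atlas cusp" "\<sigma> t \<in> cimage c" using chart_at_cusp unfolding c_def by blast+
  have cp: "cpar c = cyl_par" "cmet c = cusp_metric" using cusp_chart_atlas[OF c(1)] by metis+
  define A where "A = {t \<in> {0<..<1} - S. \<sigma> t \<in> cimage c}"
  define v where "v = vector_derivative (coord c \<circ> \<sigma>) (at t)"
  define y where "y = coord c (\<sigma> t)"
  have "t \<in> A" using t c by (simp add: A_def)
  then have "(coord c \<circ> \<sigma>) differentiable (at t)"
    using C1 c(1) unfolding A_def C1_differentiable_on_eq by blast
  then have dv: "((coord c \<circ> \<sigma>) has_derivative (\<lambda>h. h *\<^sub>R v)) (at t)"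
    unfolding v_def vector_derivative_works has_vector_derivative_def .
  have "open A"
  proof -
    obtain O' where O': "open O'" "cimage c = cyl \<inter> O'"
      using openin_cimage_cusp[OF c(1)] by (auto simp: openin_open)
    have "A = ({0<..<1} - S) \<inter> \<sigma> -` O'"
    proof -
      have "\<sigma> t \<in> cyl" if "t \<in> {0<..<1} - S" for t using cont(2) that by (auto simp: image_subset_iff)
      then show ?thesis unfolding A_def O'(2) by blast
    qed
    moreover have "open (({0<..<1} - S) \<inter> \<sigma> -` O')"
      using \<open>finite S\<close> O'(1) cont(1)
      by (intro continuous_open_preimage open_Diff finite_imp_closed)
        (auto intro: continuous_on_subset)
    ultimately show ?thesis by simp
  qed
  let ?L = "\<lambda>v. (fst v, \<chi> i. snd v $ i *\<^sub>R (\<i> * cis (snd y $ i)))"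
  have "(cyl_par has_derivative ?L) (at ((coord c \<circ> \<sigma>) t))"
    using has_derivative_cyl_par[of y] by (simp add: y_def)
  from has_derivative_compose[OF dv this]
  have "((\<lambda>s. cyl_par ((coord c \<circ> \<sigma>) s)) has_derivative (\<lambda>h. ?L (h *\<^sub>R v))) (at t)" .
  then have "(\<sigma> has_derivative (\<lambda>h. ?L (h *\<^sub>R v))) (at t)"
    by (rule has_derivative_transform_within_open[OF _ \<open>open A\<close> \<open>t \<in> A\<close>])
      (use coord_in_cdom(2)[of _ c] in \<open>auto simp: A_def cp\<close>)
  moreover have "?L (h *\<^sub>R v) = h *\<^sub>R ?L v" for h
    by (simp add: vec_eq_iff)
  ultimately have "(\<sigma> has_vector_derivative ?L v) (at t)"
    by (simp add: has_vector_derivative_def)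
  moreover have y: "fst y = fst (\<sigma> t)"
    using coord_in_cdom(2)[OF c(2)] cp by (metis fst_cyl_par y_def)
  have speed: "speed cusp \<sigma> t = sqrt ((fst v)\<^sup>2 + (exp (fst (\<sigma> t)) * norm (snd v))\<^sup>2)"
    unfolding speed_def Let_def c_def[symmetric] v_def[symmetric] y_def[symmetric] cp
    by (simp add: cusp_metric_def y power2_eq_square dot_square_norm mult_exp_exp mult_ac flip: exp_double)
  have "\<bar>fst (?L v)\<bar> \<le> speed cusp \<sigma> t" unfolding speed by (auto intro: real_le_rsqrt)
  moreover have "norm (snd (?L v)) = norm (snd v)"
    by (simp add: norm_vec_def norm_mult)
  then have "exp (fst (\<sigma> t)) * norm (snd (?L v)) \<le> speed cusp \<sigma> t"
    unfolding speed by (auto intro: real_le_rsqrt)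
  ultimately show thesis using that by blast
qed

lemma curve_length_bounds:
  fixes \<sigma> :: "real \<Rightarrow> real \<times> (complex ^ 'k::finite)"
  assumes "piecewise_C1_curve cusp \<sigma>" and len: "curve_length cusp \<sigma> < ennreal \<epsilon>" and "\<epsilon> > 0"
  shows "\<bar>fst (\<sigma> 1) - fst (\<sigma> 0)\<bar> < \<epsilon>"
    and "norm (snd (\<sigma> 1) - snd (\<sigma> 0)) < \<epsilon> * exp (\<epsilon> - fst (\<sigma> 0))"
proof -
  obtain S where cont: "continuous_on {0..1} \<sigma>" "\<sigma> ` {0..1} \<subseteq> cyl" and "finite S"
    and C1: "\<forall>c\<in>atlas cusp. (coord c \<circ> \<sigma>) C1_differentiable_on {t \<in> {0<..<1} - S. \<sigma> t \<in> cimage c}"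
    using assms(1) unfolding piecewise_C1_curve_def mtop_cusp
    by (auto simp: continuous_map_in_subtopology image_subset_iff)
  have "\<exists>D. \<forall>t\<in>{0<..<1} - S. (\<sigma> has_vector_derivative D t) (at t) \<and> \<bar>fst (D t)\<bar> \<le> speed cusp \<sigma> t
    \<and> exp (fst (\<sigma> t)) * norm (snd (D t)) \<le> speed cusp \<sigma> t"
    by (rule bchoice) (metis curve_vector_derivative[OF cont \<open>finite S\<close> C1])
  then obtain D where D: "\<And>t. t \<in> {0<..<1} - S \<Longrightarrow> (\<sigma> has_vector_derivative D t) (at t)"
    "\<And>t. t \<in> {0<..<1} - S \<Longrightarrow> \<bar>fst (D t)\<bar> \<le> speed cusp \<sigma> t"
    "\<And>t. t \<in> {0<..<1} - S \<Longrightarrow> exp (fst (\<sigma> t)) * norm (snd (D t)) \<le> speed cusp \<sigma> t"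
    by metis
  \<comment> \<open>Proved for every intermediate time, because the second bound needs control of t
    along the whole curve.\<close>
  have fst_less: "\<bar>fst (\<sigma> b) - fst (\<sigma> 0)\<bar> < \<epsilon>" if b: "b \<in> {0..1}" for b
  proof -
    have "ennreal (norm (fst (\<sigma> b) - fst (\<sigma> 0))) \<le> (\<integral>\<^sup>+t\<in>{0..b}. ennreal (speed cusp \<sigma> t) \<partial>lborel)"
    proof (rule norm_diff_le_nn_integral[OF \<open>finite S\<close>])
      show "continuous_on {0..b} (\<lambda>t. fst (\<sigma> t))"
        using b by (intro continuous_intros continuous_on_subset[OF cont(1)]) auto
      show "((\<lambda>t. fst (\<sigma> t)) has_vector_derivative fst (D t)) (at t)" if "t \<in> {0<..<b} - S" for t
        using D(1)[of t] that b has_derivative_fst unfolding has_vector_derivative_def by fastforce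
      show "norm (fst (D t)) \<le> speed cusp \<sigma> t" if "t \<in> {0<..<b} - S" for t
        using D(2)[of t] that b by auto
    qed (use b in auto)
    also have "\<dots> \<le> curve_length cusp \<sigma>"
      unfolding curve_length_def using b by (intro nn_integral_mono) (auto simp: indicator_def)
    finally have "ennreal (norm (fst (\<sigma> b) - fst (\<sigma> 0))) < ennreal \<epsilon>" using len by (rule le_less_trans)
    then show ?thesis using \<open>\<epsilon> > 0\<close> by (simp add: ennreal_less_iff)
  qed
  then show "\<bar>fst (\<sigma> 1) - fst (\<sigma> 0)\<bar> < \<epsilon>" by simp
  \<comment> \<open>A lower bound for the warping factor \<open>exp (fst (\<sigma> t))\<close> along
    the curve, by \<open>fst_less\<close>. Scaling the torus part by it makes the speed dominate its
    Euclidean derivative.\<close>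
  let ?k = "exp (fst (\<sigma> 0) - \<epsilon>)"
  have "ennreal (norm (?k *\<^sub>R snd (\<sigma> 1) - ?k *\<^sub>R snd (\<sigma> 0))) \<le> curve_length cusp \<sigma>"
    unfolding curve_length_def
  proof (rule norm_diff_le_nn_integral[OF \<open>finite S\<close>])
    show "continuous_on {0..1} (\<lambda>t. ?k *\<^sub>R snd (\<sigma> t))"
      by (intro continuous_intros cont(1))
    fix t assume t: "t \<in> {0<..<1} - S"
    have "((\<lambda>t. snd (\<sigma> t)) has_vector_derivative snd (D t)) (at t)"
      using D(1)[OF t] has_derivative_snd unfolding has_vector_derivative_def by fastforce
    then show "((\<lambda>t. ?k *\<^sub>R snd (\<sigma> t)) has_vector_derivative ?k *\<^sub>R snd (D t)) (at t)"
      by (auto intro!: derivative_eq_intros)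
    have "?k \<le> exp (fst (\<sigma> t))" using fst_less[of t] t by auto
    then have "?k * norm (snd (D t)) \<le> exp (fst (\<sigma> t)) * norm (snd (D t))" by (intro mult_right_mono) auto
    then show "norm (?k *\<^sub>R snd (D t)) \<le> speed cusp \<sigma> t" using D(3)[OF t] by simp
  qed simp
  then have "ennreal (norm (?k *\<^sub>R snd (\<sigma> 1) - ?k *\<^sub>R snd (\<sigma> 0))) < ennreal \<epsilon>"
    using len by (rule le_less_trans)
  then have "?k * norm (snd (\<sigma> 1) - snd (\<sigma> 0)) < \<epsilon>"
    using \<open>\<epsilon> > 0\<close> by (simp add: ennreal_less_iff flip: scaleR_diff_right)
  then have "norm (snd (\<sigma> 1) - snd (\<sigma> 0)) < \<epsilon> / ?k"
    by (simp add: pos_less_divide_eq mult.commute)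
  also have "\<epsilon> / ?k = \<epsilon> * exp (\<epsilon> - fst (\<sigma> 0))" by (simp add: exp_diff)
  finally show "norm (snd (\<sigma> 1) - snd (\<sigma> 0)) < \<epsilon> * exp (\<epsilon> - fst (\<sigma> 0))" .
qed

lemma rdist_bounds:
  fixes p q :: "real \<times> (complex ^ 'k::finite)"
  assumes "rdist cusp p q < ennreal \<epsilon>" "\<epsilon> > 0"
  shows "\<bar>fst q - fst p\<bar> < \<epsilon>" "norm (snd q - snd p) < \<epsilon> * exp (\<epsilon> - fst p)"
proof -
  obtain \<sigma> where "piecewise_C1_curve cusp \<sigma>" "\<sigma> 0 = p" "\<sigma> 1 = q" "curve_length cusp \<sigma> < ennreal \<epsilon>"
    using assms(1) unfolding rdist_def INF_less_iff by auto
  then show "\<bar>fst q - fst p\<bar> < \<epsilon>" "norm (snd q - snd p) < \<epsilon> * exp (\<epsilon> - fst p)"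
    using curve_length_bounds[of \<sigma> \<epsilon>] assms(2) by auto
qed

text \<open>A Cauchy sequence stays in a region \<open>t \<ge> a\<close>, where the Riemannian distance dominates
  a multiple of the Euclidean one.\<close>

lemma complete_manifold_cusp: "complete_manifold (cusp :: (_, real \<times> (real ^ 'k::finite)) rmfd)"
  unfolding complete_manifold_def mtop_cusp
proof (intro allI impI)
  fix s :: "nat \<Rightarrow> real \<times> (complex ^ 'k)"
  assume "range s \<subseteq> topspace (top_of_set cyl) \<and>
    (\<forall>\<epsilon>>0. \<exists>N. \<forall>i\<ge>N. \<forall>j\<ge>N. rdist cusp (s i) (s j) < ennreal \<epsilon>)"
  then have s: "\<And>i. s i \<in> cyl"
    and cauchy: "\<And>\<epsilon>. \<epsilon> > 0 \<Longrightarrow> \<exists>N. \<forall>i\<ge>N. \<forall>j\<ge>N. rdist cusp (s i) (s j) < ennreal \<epsilon>" by auto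
  obtain N0 where N0: "\<And>i j. i \<ge> N0 \<Longrightarrow> j \<ge> N0 \<Longrightarrow> rdist cusp (s i) (s j) < ennreal 1"
    using cauchy[of 1] by auto
  define a where "a = fst (s N0) - 1"
  have a: "a \<le> fst (s i)" if "i \<ge> N0" for i
    using rdist_bounds(1)[OF N0[of N0 i]] that by (simp add: a_def abs_if split: if_splits)
  have "Cauchy (\<lambda>i. fst (s i))"
    unfolding Cauchy_def dist_real_def using cauchy rdist_bounds(1) by meson
  moreover have "Cauchy (\<lambda>i. snd (s i))"
    unfolding Cauchy_def
  proof (intro allI impI)
    fix e :: real assume "e > 0"
    \<comment> \<open>The bound 1 replaces the exponent \<epsilon> - t by the fixed 1 - a; the
      quotient then brings the product down to at most \<open>e\<close>.\<close>
    define \<epsilon> where "\<epsilon> = min 1 (e / exp (1 - a))"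
    have \<epsilon>: "\<epsilon> > 0" "\<epsilon> \<le> 1" "\<epsilon> * exp (1 - a) \<le> e"
      using \<open>e > 0\<close> by (auto simp: \<epsilon>_def min_def field_simps)
    obtain N where N: "\<And>i j. i \<ge> N \<Longrightarrow> j \<ge> N \<Longrightarrow> rdist cusp (s i) (s j) < ennreal \<epsilon>"
      using cauchy[OF \<epsilon>(1)] by auto
    have "dist (snd (s i)) (snd (s j)) < e" if "i \<ge> max N N0" "j \<ge> max N N0" for i j
    proof -
      have "norm (snd (s j) - snd (s i)) < \<epsilon> * exp (\<epsilon> - fst (s i))"
        using N[of i j] that \<epsilon>(1) by (intro rdist_bounds) auto
      also have "\<dots> \<le> \<epsilon> * exp (1 - a)" using a[of i] that \<epsilon> by (intro mult_left_mono) auto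
      finally show ?thesis using \<epsilon>(3) by (simp add: dist_norm norm_minus_commute)
    qed
    then show "\<exists>M. \<forall>m\<ge>M. \<forall>n\<ge>M. dist (snd (s m)) (snd (s n)) < e" by blast
  qed
  ultimately obtain l1 l2 where "(\<lambda>i. fst (s i)) \<longlonglongrightarrow> l1" "(\<lambda>i. snd (s i)) \<longlonglongrightarrow> l2"
    unfolding Cauchy_convergent_iff convergent_def by metis
  then have l: "s \<longlonglongrightarrow> (l1, l2)" using tendsto_Pair by fastforce
  moreover have "closed (cyl :: (real \<times> (complex ^ 'k)) set)"
    unfolding cyl_def using closed_torus by (intro closed_Times) auto
  then have "(l1, l2) \<in> cyl" using closed_sequentially s l by blast
  ultimately show "\<exists>p. limitin (top_of_set cyl) s p sequentially"
    using s by (intro exI[of _ "(l1, l2)"]) (simp add: limitin_subtopology)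
qed

subsection \<open>The two ends\<close>

lemma connected_torus: "connected (torus :: (complex ^ 'k::finite) set)"
  unfolding range_torus_proj[symmetric]
  by (intro connected_continuous_image continuous_on_torus_proj) (rule connected_UNIV)

lemma compact_torus: "compact (torus :: (complex ^ 'k::finite) set)"
proof -
  have "norm z \<le> (\<Sum>i::'k\<in>UNIV. 1)" if "z \<in> torus" for z :: "complex ^ 'k"
    using L2_set_le_sum[of UNIV "\<lambda>i. norm (z $ i)"] that by (simp add: torus_def norm_vec_def)
  then have "bounded (torus :: (complex ^ 'k) set)" by (auto intro: boundedI)
  then show ?thesis using closed_torus by (simp add: compact_eq_bounded_closed)
qed

definition tail :: "bool \<Rightarrow> real \<Rightarrow> (real \<times> (complex ^ 'k)) set" where
  "tail b R = (if b then {R<..} else {..<-R}) \<times> torus"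

definition band :: "real \<Rightarrow> (real \<times> (complex ^ 'k)) set" where
  "band R = {-R..R} \<times> torus"

lemma connected_tail: "connected (tail b R :: (real \<times> (complex ^ 'k::finite)) set)"
  unfolding tail_def by (intro connected_Times connected_torus) auto

lemma torus_nonempty: "(\<chi> i. 1) \<in> torus"
  by (simp add: torus_def)

lemma tail_nonempty: "tail b R \<noteq> {}"
proof -
  have "(if b then R + 1 else - R - 1, \<chi> i. 1) \<in> tail b R"
    using torus_nonempty by (simp add: tail_def)
  then show ?thesis by blast
qed

lemma tail_mono: "R \<le> R' \<Longrightarrow> tail b R' \<subseteq> tail b R"
  by (auto simp: tail_def split: if_splits)

lemma tail_disjoint: "R \<ge> 0 \<Longrightarrow> R' \<ge> 0 \<Longrightarrow> tail b R \<inter> tail b' R' \<noteq> {} \<Longrightarrow> b' = b"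
  by (auto simp: tail_def split: if_splits)

lemma cyl_minus_band: "R \<ge> 0 \<Longrightarrow> cyl - band R = tail True R \<union> tail False R"
  by (auto simp: cyl_def band_def tail_def)

lemma tail_subset: "tail b R \<subseteq> cyl - band R"
  by (auto simp: cyl_def band_def tail_def)

lemma compact_band: "compact (band R :: (real \<times> (complex ^ 'k::finite)) set)"
  unfolding band_def by (intro compact_Times compact_torus) auto

lemma compactin_cyl_iff: "compactin (top_of_set cyl) K \<longleftrightarrow> compact K \<and> K \<subseteq> cyl"
  by (auto simp: compactin_subtopology)

lemma compactin_band: "compactin (top_of_set cyl) (band R :: (real \<times> (complex ^ 'k::finite)) set)"
  unfolding compactin_cyl_iff using compact_band by (auto simp: band_def cyl_def)

lemma compactin_subset_band:
  assumes "compactin (top_of_set cyl) (K :: (real \<times> (complex ^ 'k::finite)) set)"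
  obtains R where "R \<ge> 0" "K \<subseteq> band R"
proof -
  have "bounded (fst ` K)" using assms
    by (auto simp: compactin_cyl_iff intro!: compact_imp_bounded compact_continuous_image continuous_intros)
  then obtain R where R: "\<And>p. p \<in> K \<Longrightarrow> \<bar>fst p\<bar> \<le> R" by (auto simp: bounded_real)
  have "K \<subseteq> band \<bar>R\<bar>"
  proof
    fix p assume "p \<in> K"
    then have "\<bar>fst p\<bar> \<le> R" "p \<in> cyl" using R assms by (auto simp: compactin_cyl_iff)
    then show "p \<in> band \<bar>R\<bar>" by (cases p) (auto simp: band_def cyl_def)
  qed
  then show thesis using that[of "\<bar>R\<bar>"] by simp
qed

section \<open>Components of complements of compact sets\<close>

abbreviation outer_components :: "(real \<times> (complex ^ 'k)) set \<Rightarrow> (real \<times> (complex ^ 'k)) set set" where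
  "outer_components K \<equiv> connected_components_of (top_of_set (cyl - K))"

lemma outer_component_contains:
  assumes "C \<in> outer_components K" "connected S" "S \<subseteq> cyl - K" "C \<inter> S \<noteq> {}"
  shows "S \<subseteq> C"
  using assms by (intro connected_components_of_maximal[OF assms(1)])
    (auto simp: connectedin_subtopology disjnt_def)

lemma outer_component_exists:
  assumes "connected S" "S \<subseteq> cyl - K" "S \<noteq> {}"
  obtains C where "C \<in> outer_components K" "S \<subseteq> C"
proof -
  obtain x where x: "x \<in> S" using assms by blast
  then have "x \<in> \<Union> (outer_components K)" using assms(2) by (simp only: Union_connected_components_of) auto
  then obtain C where "C \<in> outer_components K" "x \<in> C" by blast
  then show thesis using outer_component_contains[of C K S] assms x that by blast
qed

lemma outer_component_connected:
  assumes "C \<in> outer_components K"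
  shows "connected C" "C \<subseteq> cyl - K" "C \<noteq> {}"
  using connectedin_connected_components_of[OF assms] nonempty_connected_components_of[OF assms]
  by (auto simp: connectedin_subtopology)

text \<open>Two tails on the same side always overlap, and distinct components do not.\<close>

lemma outer_component_unique:
  assumes "C \<in> outer_components K" "C' \<in> outer_components K" "tail b R \<subseteq> C" "tail b R' \<subseteq> C'"
  shows "C = C'"
proof -
  have "tail b (max R R') \<subseteq> C \<inter> C'" using assms(3,4) tail_mono[of R "max R R'" b] tail_mono[of R' "max R R'" b] by fastforce
  then show ?thesis using connected_components_of_overlap[OF assms(1,2)] tail_nonempty by blast
qed

text \<open>A component that met both tails would project onto a connected subset of the line
  containing points on both sides of 0, hence 0 itself, but 0 lies in the removed interval.\<close>

lemma outer_components_band: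
  assumes "R \<ge> 0"
  shows "outer_components (band R :: (real \<times> (complex ^ 'k::finite)) set) = {tail True R, tail False R}"
proof -
  have *: "C = tail b R" if C: "C \<in> outer_components (band R)" and meets: "C \<inter> tail b R \<noteq> {}"
    for C :: "(real \<times> (complex ^ 'k)) set" and b
  proof
    show sub: "tail b R \<subseteq> C" using outer_component_contains[OF C connected_tail tail_subset] meets by blast
    show "C \<subseteq> tail b R"
    proof (rule ccontr)
      assume "\<not> C \<subseteq> tail b R"
      then obtain p where "p \<in> C" and "p \<in> tail (\<not> b) R"
        using outer_component_connected(2)[OF C] cyl_minus_band[OF assms] by (cases b) auto
      moreover obtain q where "q \<in> tail b R" and "q \<in> C" using meets by blast
      moreover have "connected (fst ` C)"
        using outer_component_connected(1)[OF C] by (intro connected_continuous_image continuous_intros)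
      ultimately have "0 \<in> fst ` C"
        using assms by (cases b)
          (force simp: tail_def intro: connected_contains_Icc[THEN subsetD, of "fst ` C"])+
      then show False using outer_component_connected(2)[OF C] assms by (auto simp: band_def cyl_def)
    qed
  qed
  have "tail b R \<in> outer_components (band R :: (real \<times> (complex ^ 'k)) set)" for b
  proof -
    obtain C :: "(real \<times> (complex ^ 'k)) set" where "C \<in> outer_components (band R)" "tail b R \<subseteq> C"
      using outer_component_exists[OF connected_tail tail_subset tail_nonempty] by metis
    moreover have "C = tail b R"
      by (rule *[OF calculation(1)]) (use calculation(2) tail_nonempty in blast)
    ultimately show ?thesis by metis
  qed
  moreover have "C = tail True R \<or> C = tail False R"
    if "C \<in> outer_components (band R)" for C :: "(real \<times> (complex ^ 'k)) set"
    using *[OF that] outer_component_connected(2,3)[OF that] cyl_minus_band[OF assms] by blast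
  ultimately show ?thesis by blast
qed

text \<open>Restricted to compact sets because the members of \<open>ends\<close> are extensional
  functions. By \<open>outer_component_unique\<close> the choice is determined.\<close>

definition cyl_end :: "bool \<Rightarrow> (real \<times> (complex ^ 'k)) set \<Rightarrow> (real \<times> (complex ^ 'k)) set" where
  "cyl_end b = (\<lambda>K\<in>{K. compactin (top_of_set cyl) K}. SOME C. C \<in> outer_components K \<and> (\<exists>R. tail b R \<subseteq> C))"

lemma cyl_end:
  assumes "compactin (top_of_set cyl) (K :: (real \<times> (complex ^ 'k::finite)) set)"
  shows "cyl_end b K \<in> outer_components K" "\<exists>R. tail b R \<subseteq> cyl_end b K"
proof -
  obtain R where "K \<subseteq> band R" using compactin_subset_band[OF assms] by blast
  then have "tail b R \<subseteq> cyl - K" using tail_subset by blast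
  then obtain C where "C \<in> outer_components K" "tail b R \<subseteq> C"
    using outer_component_exists[OF connected_tail _ tail_nonempty] by metis
  then have "\<exists>C. C \<in> outer_components K \<and> (\<exists>R. tail b R \<subseteq> C)" by blast
  from someI_ex[OF this]
  show "cyl_end b K \<in> outer_components K" "\<exists>R. tail b R \<subseteq> cyl_end b K"
    using assms by (simp_all add: cyl_end_def)
qed

lemma cyl_end_eqI:
  assumes "compactin (top_of_set cyl) (K :: (real \<times> (complex ^ 'k::finite)) set)"
    and "C \<in> outer_components K" "tail b R \<subseteq> C"
  shows "cyl_end b K = C"
  using cyl_end[OF assms(1)] assms(2,3) outer_component_unique by metis

lemma cyl_end_band:
  "R \<ge> 0 \<Longrightarrow> cyl_end b (band R :: (real \<times> (complex ^ 'k::finite)) set) = tail b R"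
  using outer_components_band[of R] by (intro cyl_end_eqI[OF compactin_band, where R = R]) (cases b; auto)+

text \<open>Every compact set lies in a band, so an end is determined by its values on bands. Each
  of these values is a tail, and monotonicity forces all tails to lie on the side chosen for
  \<open>band 0\<close>.\<close>

lemma ends_cyl:
  "ends (top_of_set (cyl :: (real \<times> (complex ^ 'k::finite)) set)) = {cyl_end True, cyl_end False}"
proof -
  let ?X = "top_of_set (cyl :: (real \<times> (complex ^ 'k)) set)"
  have sub: "subtopology ?X (topspace ?X - K) = top_of_set (cyl - K)" for K :: "(real \<times> (complex ^ 'k)) set"
    by (simp add: subtopology_subtopology Int_absorb1 Diff_subset)
  have "cyl_end b \<in> ends ?X" for b
    unfolding ends_def sub
  proof (intro CollectI conjI allI impI)
    show "cyl_end b \<in> (\<Pi>\<^sub>E K\<in>{K. compactin ?X K}. outer_components K)"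
      proof (rule PiE_I)
      show "cyl_end b K = undefined" if "K \<notin> {K. compactin ?X K}" for K
        using that by (simp add: cyl_end_def)
    qed (use cyl_end(1) in blast)
    fix K L :: "(real \<times> (complex ^ 'k)) set" assume *: "compactin ?X K \<and> compactin ?X L \<and> K \<subseteq> L"
    then have L: "cyl_end b L \<in> outer_components L" using cyl_end by blast
    then have "cyl_end b L \<subseteq> cyl - K" "connected (cyl_end b L)" "cyl_end b L \<noteq> {}"
      using outer_component_connected[OF L] * by auto
    then obtain C where C: "C \<in> outer_components K" "cyl_end b L \<subseteq> C"
      using outer_component_exists by metis
    moreover obtain R where "tail b R \<subseteq> cyl_end b L" using cyl_end * by blast
    ultimately have "cyl_end b K = C" using * by (intro cyl_end_eqI) auto
    then show "cyl_end b L \<subseteq> cyl_end b K" using C by simp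
  qed
  moreover have "e = cyl_end True \<or> e = cyl_end False" if "e \<in> ends ?X" for e
  proof -
    have PiE: "e \<in> (\<Pi>\<^sub>E K\<in>{K. compactin ?X K}. outer_components K)"
      and mono: "\<And>K L. compactin ?X K \<Longrightarrow> compactin ?X L \<Longrightarrow> K \<subseteq> L \<Longrightarrow> e L \<subseteq> e K"
      using that unfolding ends_def sub by auto
    have eband: "\<exists>b. e (band R) = tail b R" if "R \<ge> 0" for R
    proof -
      have "e (band R) \<in> outer_components (band R)"
        using PiE_mem[OF PiE] compactin_band by (metis mem_Collect_eq)
      then show ?thesis unfolding outer_components_band[OF that] by blast
    qed
    obtain b where b: "e (band 0) = tail b 0" using eband by auto
    have eb: "e (band R) = tail b R" if R: "R \<ge> 0" for R
    proof -
      obtain b' where b': "e (band R) = tail b' R" using eband[OF R] by auto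
      have "e (band R) \<subseteq> e (band 0)"
        using R by (intro mono compactin_band) (auto simp: band_def)
      then have "tail b 0 \<inter> tail b' R = (tail b' R :: (real \<times> (complex ^ 'k)) set)"
        by (simp only: b b' inf.absorb2)
      then have "tail b 0 \<inter> tail b' R \<noteq> ({} :: (real \<times> (complex ^ 'k)) set)"
        by (simp only: tail_nonempty not_False_eq_True)
      then have "b' = b" by (rule tail_disjoint[OF order_refl R])
      then show ?thesis using b' by simp
    qed
    have "e K = cyl_end b K" if K: "compactin ?X K" for K
    proof -
      obtain R where R: "R \<ge> 0" "K \<subseteq> band R" using compactin_subset_band[OF K] by blast
      then have "tail b R \<subseteq> e K" using mono[OF K compactin_band R(2)] eb by simp
      moreover have "e K \<in> outer_components K" using PiE_mem[OF PiE] K by auto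
      ultimately show ?thesis using cyl_end_eqI[OF K] by metis
    qed
    moreover have "e K = cyl_end b K" if "\<not> compactin ?X K" for K
      using PiE_arb[OF PiE] that by (simp add: cyl_end_def)
    ultimately have "e = cyl_end b" by blast
    then show ?thesis by (cases b) auto
  qed
  ultimately show ?thesis by blast
qed

lemma card_ends_cusp: "card (ends (mtop (cusp :: (_, real \<times> (real ^ 'k::finite)) rmfd))) = 2"
proof -
  have "cyl_end True (band 0 :: (real \<times> (complex ^ 'k)) set) \<noteq> cyl_end False (band 0)"
    using tail_disjoint[of 0 0 True False, where 'a = 'k] tail_nonempty[of True 0, where 'a = 'k] by (auto simp: cyl_end_band)
  then have "(cyl_end True :: (real \<times> (complex ^ 'k)) set \<Rightarrow> _) \<noteq> cyl_end False" by metis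
  then show ?thesis by (simp add: mtop_cusp ends_cyl)
qed

subsection \<open>Symmetry of second derivatives\<close>

text \<open>The mean value theorem in direction u turns the numerator into h times the increment of
  \<open>pd f _ u\<close> over the step h v. Differentiability of that function at x alone gives the
  increment up to o(h).\<close>

lemma second_difference_quotient_tendsto:
  fixes f :: "'e::real_normed_vector \<Rightarrow> real"
  assumes "open S" "x \<in> S" and f: "\<And>y. y \<in> S \<Longrightarrow> f differentiable (at y)"
    and g: "(\<lambda>y. pd f y u) differentiable (at x)"
  shows "((\<lambda>h. (f (x + h *\<^sub>R u + h *\<^sub>R v) - f (x + h *\<^sub>R u) - f (x + h *\<^sub>R v) + f x) / h\<^sup>2)
    \<longlongrightarrow> pd (\<lambda>y. pd f y u) x v) (at_right 0)"
proof (rule tendstoI)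
  define g where "g = (\<lambda>y. pd f y u)"
  define A where "A = pd g x"
  define n where "n = norm u + norm v + 1"
  have n: "n > 0" by (auto simp: n_def intro: add_nonneg_pos)
  have gA: "(g has_derivative A) (at x)"
    using g unfolding g_def A_def frechet_derivative_works .
  then have linA: "linear A" by (rule has_derivative_linear)
  fix e :: real assume "e > 0"
  \<comment> \<open>All displacements used have norm below h n. The linearization errors at two
    points then add up to at most 2 e' h n = h e / 2.\<close>
  define e' where "e' = e / (4 * n)"
  have e': "e' > 0" using \<open>e > 0\<close> n by (simp add: e'_def)
  obtain d1 where d1: "d1 > 0" "\<And>y. norm (y - x) < d1 \<Longrightarrow> norm (g y - g x - A (y - x)) \<le> e' * norm (y - x)"
    using gA e' unfolding has_derivative_at_alt by blast
  obtain d2 where d2: "d2 > 0" "ball x d2 \<subseteq> S" using assms(1,2) openE by blast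
  define d where "d = min d1 d2 / n"
  have "d > 0" using d1 d2 n by (simp add: d_def)
  have "dist ((f (x + h *\<^sub>R u + h *\<^sub>R v) - f (x + h *\<^sub>R u) - f (x + h *\<^sub>R v) + f x) / h\<^sup>2) (A v) < e"
    if h: "0 < h" "h < d" for h
  proof -
    have hn: "h * n < d1" "h * n < d2" using h n by (simp_all add: d_def field_simps)
    have nb: "norm (t *\<^sub>R u + s *\<^sub>R v) < h * n" if "0 \<le> t" "t \<le> h" "0 \<le> s" "s \<le> h" for s t
    proof -
      have "norm (t *\<^sub>R u + s *\<^sub>R v) \<le> t * norm u + s * norm v"
        using norm_triangle_ineq[of "t *\<^sub>R u" "s *\<^sub>R v"] that by simp
      also have "\<dots> \<le> h * norm u + h * norm v" using that by (intro add_mono mult_right_mono) auto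
      also have "\<dots> < h * n" using h by (simp add: n_def algebra_simps)
      finally show ?thesis .
    qed
    have inS: "x + t *\<^sub>R u + s *\<^sub>R v \<in> S" if "0 \<le> t" "t \<le> h" "0 \<le> s" "s \<le> h" for s t
    proof -
      have "dist x (x + t *\<^sub>R u + s *\<^sub>R v) = norm (t *\<^sub>R u + s *\<^sub>R v)"
        by (subst dist_commute) (simp add: dist_norm add.assoc)
      then show ?thesis using nb[OF that] hn d2 by (auto simp: subset_iff)
    qed
    have df: "((\<lambda>t. f (x + t *\<^sub>R u + s *\<^sub>R v)) has_real_derivative g (x + t *\<^sub>R u + s *\<^sub>R v)) (at t)"
      if "0 \<le> t" "t \<le> h" "0 \<le> s" "s \<le> h" for s t
    proof -
      have "(f has_derivative pd f (x + t *\<^sub>R u + s *\<^sub>R v)) (at (x + t *\<^sub>R u + s *\<^sub>R v))"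
        using f[OF inS[OF that]] frechet_derivative_works by blast
      moreover have "((\<lambda>t. x + t *\<^sub>R u + s *\<^sub>R v) has_derivative (\<lambda>r. r *\<^sub>R u)) (at t)"
        by (auto intro!: derivative_eq_intros)
      ultimately have "((\<lambda>t. f (x + t *\<^sub>R u + s *\<^sub>R v)) has_derivative
          (\<lambda>r. pd f (x + t *\<^sub>R u + s *\<^sub>R v) (r *\<^sub>R u))) (at t)"
        by (rule has_derivative_compose[rotated])
      moreover have "linear (pd f (x + t *\<^sub>R u + s *\<^sub>R v))"
        using f[OF inS[OF that]] linear_frechet_derivative by blast
      ultimately show ?thesis
        by (simp add: has_field_derivative_def linear_cmul g_def mult_commute_abs)
    qed
    have "\<exists>z. 0 < z \<and> z < h \<and>
        (\<lambda>t. f (x + t *\<^sub>R u + h *\<^sub>R v) - f (x + t *\<^sub>R u + 0 *\<^sub>R v)) h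
        - (\<lambda>t. f (x + t *\<^sub>R u + h *\<^sub>R v) - f (x + t *\<^sub>R u + 0 *\<^sub>R v)) 0
        = (h - 0) * (g (x + z *\<^sub>R u + h *\<^sub>R v) - g (x + z *\<^sub>R u + 0 *\<^sub>R v))"
      using h by (intro MVT2 DERIV_diff df) auto
    then obtain z where z: "0 < z" "z < h"
      "f (x + h *\<^sub>R u + h *\<^sub>R v) - f (x + h *\<^sub>R u) - f (x + h *\<^sub>R v) + f x
        = h * (g (x + z *\<^sub>R u + h *\<^sub>R v) - g (x + z *\<^sub>R u))"
      by auto
    let ?p = "z *\<^sub>R u + h *\<^sub>R v" and ?q = "z *\<^sub>R u"
    have np: "norm ?p < h * n" "norm ?q < h * n" using nb[of z h] nb[of z 0] z h by auto
    have "norm (g (x + ?p) - g x - A ?p) \<le> e' * norm ?p" "norm (g (x + ?q) - g x - A ?q) \<le> e' * norm ?q"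
      using d1(2)[of "x + ?p"] d1(2)[of "x + ?q"] np hn by auto
    moreover have "A ?p - A ?q = h * A v" by (simp add: linear_add[OF linA] linear_cmul[OF linA])
    ultimately have "\<bar>g (x + ?p) - g (x + ?q) - h * A v\<bar> \<le> e' * norm ?p + e' * norm ?q"
      unfolding real_norm_def by linarith
    also have "\<dots> \<le> e' * (h * n) + e' * (h * n)" using np e' by (intro add_mono mult_left_mono) auto
    also have "\<dots> = h * (e / 2)" using n by (simp add: e'_def)
    finally have "\<bar>g (x + ?p) - g (x + ?q) - h * A v\<bar> / h \<le> e / 2" using h by (simp add: field_simps)
    moreover have "(g (x + ?p) - g (x + ?q)) / h - A v = (g (x + ?p) - g (x + ?q) - h * A v) / h"
      using h by (simp add: field_simps)
    ultimately have "\<bar>(g (x + ?p) - g (x + ?q)) / h - A v\<bar> \<le> e / 2"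
      using h by (simp add: abs_divide)
    moreover have "(f (x + h *\<^sub>R u + h *\<^sub>R v) - f (x + h *\<^sub>R u) - f (x + h *\<^sub>R v) + f x) / h\<^sup>2
        = (g (x + ?p) - g (x + ?q)) / h"
      using h unfolding z(3) by (simp add: power2_eq_square add.assoc)
    ultimately show ?thesis using \<open>e > 0\<close> by (simp add: dist_real_def)
  qed
  then show "\<forall>\<^sub>F h in at_right 0. dist ((f (x + h *\<^sub>R u + h *\<^sub>R v) - f (x + h *\<^sub>R u) - f (x + h *\<^sub>R v) + f x) / h\<^sup>2)
      (pd (\<lambda>y. pd f y u) x v) < e"
    using \<open>d > 0\<close> unfolding eventually_at_right_field A_def g_def by auto
qed

text \<open>The second difference is symmetric in u and v, so both mixed derivatives are limits of
  the same quotient.\<close>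

lemma pd_pd_commute_real:
  fixes f :: "'e::real_normed_vector \<Rightarrow> real"
  assumes "open S" "x \<in> S" "\<And>y. y \<in> S \<Longrightarrow> f differentiable (at y)"
    and "(\<lambda>y. pd f y u) differentiable (at x)" "(\<lambda>y. pd f y v) differentiable (at x)"
  shows "pd (\<lambda>y. pd f y u) x v = pd (\<lambda>y. pd f y v) x u"
proof (rule tendsto_unique[OF trivial_limit_at_right_real])
  show "((\<lambda>h. (f (x + h *\<^sub>R u + h *\<^sub>R v) - f (x + h *\<^sub>R u) - f (x + h *\<^sub>R v) + f x) / h\<^sup>2)
    \<longlongrightarrow> pd (\<lambda>y. pd f y u) x v) (at_right 0)"
    by (rule second_difference_quotient_tendsto[OF assms(1,2,3,4)])
  have "(f (x + h *\<^sub>R v + h *\<^sub>R u) - f (x + h *\<^sub>R v) - f (x + h *\<^sub>R u) + f x) =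
      (f (x + h *\<^sub>R u + h *\<^sub>R v) - f (x + h *\<^sub>R u) - f (x + h *\<^sub>R v) + f x)" for h
    by (simp add: add.assoc add.commute[of "h *\<^sub>R v"])
  then show "((\<lambda>h. (f (x + h *\<^sub>R u + h *\<^sub>R v) - f (x + h *\<^sub>R u) - f (x + h *\<^sub>R v) + f x) / h\<^sup>2)
    \<longlongrightarrow> pd (\<lambda>y. pd f y v) x u) (at_right 0)"
    using second_difference_quotient_tendsto[OF assms(1,2,3,5), of u] by (simp only:)
qed

lemma pd_inner:
  assumes "f differentiable (at y)"
  shows "pd (\<lambda>y. f y \<bullet> b) y v = pd f y v \<bullet> b"
proof -
  have "((\<lambda>y. f y \<bullet> b) has_derivative (\<lambda>v. pd f y v \<bullet> b)) (at y)"
    using assms unfolding frechet_derivative_works by (rule has_derivative_inner_left)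
  from frechet_derivative_at[OF this] show ?thesis by metis
qed

lemma pd_pd_commute:
  fixes f :: "'e::real_normed_vector \<Rightarrow> 'f::euclidean_space"
  assumes "open S" "x \<in> S" and f: "\<And>y. y \<in> S \<Longrightarrow> f differentiable (at y)"
    and u: "(\<lambda>y. pd f y u) differentiable (at x)" and v: "(\<lambda>y. pd f y v) differentiable (at x)"
  shows "pd (\<lambda>y. pd f y u) x v = pd (\<lambda>y. pd f y v) x u"
proof (rule euclidean_eqI)
  fix b :: 'f
  have eq: "pd f y w \<bullet> b = pd (\<lambda>y. f y \<bullet> b) y w" if "y \<in> S" for y w using pd_inner[OF f[OF that]] by simp
  have d: "(\<lambda>y. pd (\<lambda>y. f y \<bullet> b) y w) differentiable (at x) \<and>
      pd (\<lambda>y. pd (\<lambda>y. f y \<bullet> b) y w) x z = pd (\<lambda>y. pd f y w) x z \<bullet> b"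
    if "(\<lambda>y. pd f y w) differentiable (at x)" for w z
  proof -
    have "((\<lambda>y. pd f y w \<bullet> b) has_derivative (\<lambda>z. pd (\<lambda>y. pd f y w) x z \<bullet> b)) (at x)"
      using that unfolding frechet_derivative_works by (rule has_derivative_inner_left)
    from has_derivative_transform_within_open[OF this assms(1,2) eq]
    have "((\<lambda>y. pd (\<lambda>y. f y \<bullet> b) y w) has_derivative (\<lambda>z. pd (\<lambda>y. pd f y w) x z \<bullet> b)) (at x)" .
    from differentiableI[OF this] frechet_derivative_at[OF this] show ?thesis by metis
  qed
  have "(\<lambda>y. f y \<bullet> b) differentiable (at y)" if "y \<in> S" for y
    using f[OF that] unfolding differentiable_def by (blast intro: has_derivative_inner_left)
  then have "pd (\<lambda>y. pd (\<lambda>y. f y \<bullet> b) y u) x v = pd (\<lambda>y. pd (\<lambda>y. f y \<bullet> b) y v) x u"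
    using pd_pd_commute_real[OF assms(1,2), of "\<lambda>y. f y \<bullet> b"] d[OF u] d[OF v] by blast
  then show "pd (\<lambda>y. pd f y u) x v \<bullet> b = pd (\<lambda>y. pd f y v) x u \<bullet> b"
    using d[OF u] d[OF v] by simp
qed

text \<open>\<open>Ck_on\<close> speaks of basis directions only; derivatives in a general direction
  are linear combinations of these.\<close>

lemma smooth_on_differentiable:
  assumes "smooth_on f S" "open S" "y \<in> S"
  shows "f differentiable (at y)" "(\<lambda>y. pd f y v) differentiable (at y)"
proof -
  have 1: "Ck_on (Suc (Suc 0)) f S" using assms by (simp only: smooth_on_def)
  then show "f differentiable (at y)" using assms by simp
  have "pd f z v = (\<Sum>b\<in>Basis. (v \<bullet> b) *\<^sub>R pd f z b)" if "z \<in> S" for z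
  proof -
    have lin: "linear (pd f z)" using 1 that by (simp add: linear_frechet_derivative)
    have "pd f z (\<Sum>b\<in>Basis. (v \<bullet> b) *\<^sub>R b) = (\<Sum>b\<in>Basis. (v \<bullet> b) *\<^sub>R pd f z b)"
      by (simp only: linear_sum[OF lin] linear_cmul[OF lin])
    then show ?thesis by (simp add: euclidean_representation)
  qed
  moreover have "(\<lambda>z. \<Sum>b\<in>Basis. (v \<bullet> b) *\<^sub>R pd f z b) differentiable (at y)"
    using 1 assms(3) by (intro derivative_intros) (auto intro: differentiable_scaleR)
  ultimately show "(\<lambda>y. pd f y v) differentiable (at y)"
    using assms(2,3) has_derivative_transform_within_open
    unfolding differentiable_def by (metis (no_types, lifting))
qed


subsection \<open>Nonexistence of a product structure\<close>

text \<open>Used for the coefficients of a product metric, which do not change along the line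
  factor.\<close>

lemma has_derivative_constant_along:
  fixes f :: "'e::real_normed_vector \<Rightarrow> real"
  assumes f: "(f has_derivative f') (at y)" and "open U" "y \<in> U"
    and const: "\<And>t. y + t *\<^sub>R e \<in> U \<Longrightarrow> f (y + t *\<^sub>R e) = f y"
  shows "f' e = 0"
proof -
  have "((\<lambda>t::real. y + t *\<^sub>R e) has_derivative (\<lambda>t. t *\<^sub>R e)) (at 0)"
    by (auto intro!: derivative_eq_intros)
  moreover have "(f has_derivative f') (at (y + 0 *\<^sub>R e))" using f by simp
  ultimately have "((\<lambda>t. f (y + t *\<^sub>R e)) has_derivative (\<lambda>t. f' (t *\<^sub>R e))) (at 0)"
    by (rule has_derivative_compose)
  moreover have "((\<lambda>t. f (y + t *\<^sub>R e)) has_derivative (\<lambda>t. 0)) (at 0)"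
  proof (rule has_derivative_transform_within_open[of "\<lambda>t. f y"])
    show "open ((\<lambda>t. y + t *\<^sub>R e) -` U)"
      using assms(2) by (intro open_vimage continuous_intros)
  qed (use assms in auto)
  ultimately have "(\<lambda>t. f' (t *\<^sub>R e)) = (\<lambda>t. 0)" by (rule has_derivative_unique)
  from fun_cong[OF this, of 1] show ?thesis by simp
qed


text \<open>In the coordinates of a product, \<open>S = (1, 0)\<close> would be a parallel unit field (by the Koszul
  formula). With \<open>H = (T, Y)\<close>, this makes the derivative of \<open>\<phi> = T\<^sub>S e\<^sup>T\<close> equal to \<open>e\<^sup>T ds\<close>, so the
  symmetry of the second derivatives of \<open>\<phi>\<close> forces \<open>T\<close> to depend on \<open>s\<close> only; hence \<open>dH S\<close> is
  \<open>\<plusminus>\<partial>\<^sub>t\<close>, which is not parallel.\<close>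

lemma no_product_coordinates:
  fixes H :: "real \<times> 'f::euclidean_space \<Rightarrow> real \<times> (real ^ 'k::finite)"
    and h :: "'f \<Rightarrow> 'f \<Rightarrow> 'f \<Rightarrow> real"
  assumes U: "open U" "y\<^sub>0 \<in> U" and H: "smooth_on H U"
    and h: "\<And>y. y \<in> U \<Longrightarrow> bilinear (h (snd y))"
    and surj: "\<And>y. y \<in> U \<Longrightarrow> surj (pd H y)"
    and metric: "\<And>y v w. y \<in> U \<Longrightarrow>
      cusp_metric (H y) (pd H y v) (pd H y w) = fst v * fst w + h (snd y) (snd v) (snd w)"
  shows False
proof -
  define S :: "real \<times> 'f" where "S = (1, 0)"
  define P where "P = (\<lambda>v y. pd H y v)"
  define Q where "Q = (\<lambda>v u y. pd (P v) y u)"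
  define T where "T = (\<lambda>y. exp (2 * fst (H y)))"
  define h0 where "h0 = (\<lambda>(y :: real \<times> 'f) (v :: real \<times> 'f) (w :: real \<times> 'f). h (snd y) (snd v) (snd w))"
  have T: "T y > 0" for y by (simp add: T_def)
  have E: "fst (P v y) * fst (P w y) + T y * (snd (P v y) \<bullet> snd (P w y)) = fst v * fst w + h0 y v w"
    if "y \<in> U" for y v w
    using metric[OF that, of v w] by (simp add: cusp_metric_def P_def T_def h0_def)
  have dH: "(H has_derivative (\<lambda>u. P u y)) (at y)" if "y \<in> U" for y
    using smooth_on_differentiable(1)[OF H U(1) that] unfolding frechet_derivative_works P_def .
  have dP: "(P v has_derivative (\<lambda>u. Q v u y)) (at y)" if "y \<in> U" for y v
    using smooth_on_differentiable(2)[OF H U(1) that] unfolding frechet_derivative_works P_def Q_def .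
  have linP: "linear (\<lambda>u. P u y)" if "y \<in> U" for y using dH[OF that] by (rule has_derivative_linear)
  have sym: "Q v u y = Q u v y" if "y \<in> U" for u v y
    using pd_pd_commute[OF U(1) that, of H u v] smooth_on_differentiable[OF H U(1)] that
    unfolding Q_def P_def by simp
  have hS: "h0 y S w = 0" "h0 y v S = 0" if "y \<in> U" for y v w
    using bilinear_lzero[OF h[OF that]] bilinear_rzero[OF h[OF that]] by (simp_all add: h0_def S_def)
  have dT: "(T has_derivative (\<lambda>u. 2 * fst (P u y) * T y)) (at y)" if "y \<in> U" for y
    unfolding T_def by (rule derivative_eq_intros dH[OF that] refl | simp add: mult.commute)+
  have dE: "((\<lambda>y. fst v * fst w + h0 y v w) has_derivative (\<lambda>u. fst (Q v u y) * fst (P w y) + fst (P v y) * fst (Q w u y)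
      + 2 * fst (P u y) * T y * (snd (P v y) \<bullet> snd (P w y))
      + T y * (snd (Q v u y) \<bullet> snd (P w y) + snd (P v y) \<bullet> snd (Q w u y)))) (at y)"
    if "y \<in> U" for y v w
  proof (rule has_derivative_transform_within_open[OF _ U(1) that E])
    show "((\<lambda>y. fst (P v y) * fst (P w y) + T y * (snd (P v y) \<bullet> snd (P w y))) has_derivative
      (\<lambda>u. fst (Q v u y) * fst (P w y) + fst (P v y) * fst (Q w u y)
      + 2 * fst (P u y) * T y * (snd (P v y) \<bullet> snd (P w y))
      + T y * (snd (Q v u y) \<bullet> snd (P w y) + snd (P v y) \<bullet> snd (Q w u y)))) (at y)"
      by (rule derivative_eq_intros dT[OF that] dP[OF that] refl ext | simp add: algebra_simps)+
  qed
  have parallel: "fst (Q S v y) = T y * (snd (P v y) \<bullet> snd (P S y)) \<and>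
      snd (Q S v y) = - (fst (P v y) *\<^sub>R snd (P S y) + fst (P S y) *\<^sub>R snd (P v y))" if y: "y \<in> U" for y v
  proof -
    \<comment> \<open>\<open>(A, B)\<close> is the covariant derivative of dH S in direction v: the
      coordinate derivative plus the Christoffel term of the cusp. The vector \<open>w\<close> is
      chosen with image \<open>(A, B)\<close>, so that pairing with it yields the squared
      length.\<close>
    define A where "A = fst (Q S v y) - T y * (snd (P v y) \<bullet> snd (P S y))"
    define B where "B = snd (Q S v y) + (fst (P v y) *\<^sub>R snd (P S y) + fst (P S y) *\<^sub>R snd (P v y))"
    obtain w where w: "P w y = (A, B)" using surj[OF y] unfolding P_def surj_def by metis
    have const: "((\<lambda>y. fst v * fst w + h0 y v w) has_derivative (\<lambda>_. 0)) (at y)"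
      if "v = S \<or> w = S" for v w
    proof (rule has_derivative_transform_within_open[OF has_derivative_const[of "fst v * fst w"] U(1) y])
      fix x assume "x \<in> U"
      then show "fst v * fst w = fst v * fst w + h0 x v w"
        using hS(1)[of x w] hS(2)[of x v] that by (elim disjE) simp_all
    qed
    note zero = fun_cong[OF has_derivative_unique[OF dE[OF y] const]]
    \<comment> \<open>The three facts say that v g(S,w), S g(v,w) and w g(v,S) vanish for the
      product metric.\<close>
    have 1: "fst (Q S v y) * fst (P w y) + fst (P S y) * fst (Q w v y)
      + 2 * fst (P v y) * T y * (snd (P S y) \<bullet> snd (P w y))
      + T y * (snd (Q S v y) \<bullet> snd (P w y) + snd (P S y) \<bullet> snd (Q w v y)) = 0"
      using zero[of S w v] by simp
    have 2: "fst (Q v S y) * fst (P w y) + fst (P v y) * fst (Q w S y)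
      + 2 * fst (P S y) * T y * (snd (P v y) \<bullet> snd (P w y))
      + T y * (snd (Q v S y) \<bullet> snd (P w y) + snd (P v y) \<bullet> snd (Q w S y)) = 0"
      by (rule has_derivative_constant_along[OF dE[OF y] U(1) y]) (simp add: S_def h0_def)
    have 3: "fst (Q v w y) * fst (P S y) + fst (P v y) * fst (Q S w y)
      + 2 * fst (P w y) * T y * (snd (P v y) \<bullet> snd (P S y))
      + T y * (snd (Q v w y) \<bullet> snd (P S y) + snd (P v y) \<bullet> snd (Q S w y)) = 0"
      using zero[of v S w] by simp
    \<comment> \<open>The Koszul formula: 1 + 2 - 3 is twice the product of the covariant derivative
      with dH w.\<close>
    have "fst (P w y) * A + T y * (snd (P w y) \<bullet> B) = 0"
      using 1 2 3 unfolding sym[OF y, of v S] sym[OF y, of w S] sym[OF y, of w v] A_def B_def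
      by (simp add: inner_add_right inner_commute algebra_simps)
    then have "A * A + T y * (B \<bullet> B) = 0" by (simp add: w)
    moreover have "A * A \<ge> 0" "T y * (B \<bullet> B) \<ge> 0" using T[of y] by auto
    ultimately have "A * A = 0" "T y * (B \<bullet> B) = 0" by linarith+
    then have "A = 0" "B = 0" using T[of y] by auto
    then show ?thesis unfolding A_def B_def by (simp only: eq_neg_iff_add_eq_0 right_minus_eq)
  qed
  \<comment> \<open>This is the derivative of e^t along S. Since e^t has Hessian e^t g and S is
    parallel, its differential is e^t g(S, _), which in product coordinates is e^t ds.\<close>
  define \<phi> where "\<phi> = (\<lambda>y. fst (P S y) * exp (fst (H y)))"
  have d\<phi>: "(\<phi> has_derivative (\<lambda>v. fst v * exp (fst (H y)))) (at y)" if y: "y \<in> U" for y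
  proof -
    have "(\<phi> has_derivative (\<lambda>v. fst (Q S v y) * exp (fst (H y))
        + fst (P S y) * (fst (P v y) * exp (fst (H y))))) (at y)"
      unfolding \<phi>_def
      by (rule derivative_eq_intros dP[OF y] dH[OF y] refl ext | simp add: algebra_simps)+
    moreover have "fst (Q S v y) * exp (fst (H y)) + fst (P S y) * (fst (P v y) * exp (fst (H y)))
        = fst v * exp (fst (H y))" for v
    proof -
      have "fst (Q S v y) + fst (P S y) * fst (P v y) = fst v"
        using conjunct1[OF parallel[OF y, of v]] E[OF y, of v S] hS[OF y]
        by (simp add: mult.commute) (simp add: S_def)
      then show ?thesis by (simp flip: distrib_right mult.assoc)
    qed
    ultimately show ?thesis by (simp only:)
  qed
  have pd\<phi>: "pd \<phi> y v = fst v * exp (fst (H y))" if "y \<in> U" for y v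
    using frechet_derivative_at[OF d\<phi>[OF that]] by metis
  have T0: "fst (P v y) = 0" if y: "y \<in> U" and v: "fst v = 0" for y v
  proof -
    have *: "((\<lambda>y. pd \<phi> y u) has_derivative (\<lambda>w. fst u * (fst (P w y) * exp (fst (H y))))) (at y)" for u
    proof (rule has_derivative_transform_within_open[OF _ U(1) y pd\<phi>[symmetric]])
      show "((\<lambda>y. fst u * exp (fst (H y))) has_derivative (\<lambda>w. fst u * (fst (P w y) * exp (fst (H y))))) (at y)"
        by (rule derivative_eq_intros dH[OF y] refl ext | simp add: algebra_simps)+
    qed
    \<comment> \<open>Symmetry says that \<open>fst u * fst (P w y)\<close> is symmetric in u and w;
      u = S and w = v leave only \<open>fst (P v y)\<close>.\<close>
    have "pd (\<lambda>y. pd \<phi> y S) y v = pd (\<lambda>y. pd \<phi> y v) y S"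
      using pd_pd_commute_real[OF U(1) y, of \<phi> S v] differentiableI[OF *] differentiableI[OF d\<phi>] by blast
    moreover have "pd (\<lambda>y. pd \<phi> y u) y w = fst u * (fst (P w y) * exp (fst (H y)))" for u w
      using frechet_derivative_at[OF *] by metis
    ultimately show ?thesis using v by (simp add: S_def)
  qed
  have YS: "fst (P S y) \<noteq> 0 \<and> snd (P S y) = 0" if y: "y \<in> U" for y
  proof -
    obtain w where w: "P w y = (1, 0)" using surj[OF y] unfolding P_def surj_def by metis
    \<comment> \<open>The part of \<open>w\<close> tangent to N. Its square length is h(w,w') =
      g(w,w') = \<open>fst (P ?w' y)\<close>, which is 0 by \<open>T0\<close>; hence its image
      vanishes and \<partial>t is a multiple of dH S.\<close>
    let ?w' = "(0, snd w) :: real \<times> 'f"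
    have "cusp_metric (H y) (P ?w' y) (P ?w' y) = 0"
      using E[OF y, of w ?w'] E[OF y, of ?w' ?w'] T0[OF y, of ?w']
      by (simp add: w h0_def cusp_metric_def T_def)
    then have "P ?w' y = 0"
      using T0[OF y, of ?w'] by (simp add: cusp_metric_def prod_eq_iff)
    moreover have "w = fst w *\<^sub>R S + ?w'" by (simp add: S_def prod_eq_iff)
    then have "P w y = fst w *\<^sub>R P S y + P ?w' y"
      using linear_add[OF linP[OF y]] linear_cmul[OF linP[OF y]] by metis
    ultimately have "(1, 0) = fst w *\<^sub>R P S y" using w by simp
    then show ?thesis by (auto simp: prod_eq_iff)
  qed
  have Q0: "snd (Q S v y\<^sub>0) = 0" for v
  proof -
    have "((\<lambda>y. snd (P S y)) has_derivative (\<lambda>v. snd (Q S v y\<^sub>0))) (at y\<^sub>0)"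
      by (rule has_derivative_snd[OF dP[OF U(2)]])
    moreover have "((\<lambda>y. snd (P S y)) has_derivative (\<lambda>v. 0)) (at y\<^sub>0)"
      by (rule has_derivative_transform_within_open[OF has_derivative_const[of 0] U]) (use YS in auto)
    ultimately have "(\<lambda>v. snd (Q S v y\<^sub>0)) = (\<lambda>v. 0)" by (rule has_derivative_unique)
    then show ?thesis by metis
  qed
  \<comment> \<open>Parallelism now reads
    \<open>fst (P S y\<^sub>0) *\<^sub>R snd (P v y\<^sub>0) = 0\<close> with a nonzero factor. So
    the image of dH has no torus component, against surjectivity.\<close>
  have "snd (P v y\<^sub>0) = 0" for v
    using parallel[OF U(2), of v] Q0[of v] YS[OF U(2)] by simp
  moreover obtain v where "P v y\<^sub>0 = (0, 1)"
    using surj[OF U(2)] unfolding P_def surj_def by metis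
  ultimately show False by (metis snd_conv zero_neq_one)
qed

section \<open>From an isometry to product coordinates\<close>

lemma pd_inverse:
  fixes H :: "'e::real_normed_vector \<Rightarrow> 'f::real_normed_vector"
  assumes "open U" "y \<in> U" and KH: "\<And>z. z \<in> U \<Longrightarrow> K (H z) = z"
    and "H differentiable (at y)" "K differentiable (at (H y))"
  shows "pd K (H y) (pd H y v) = v"
proof -
  have "(H has_derivative pd H y) (at y)" "(K has_derivative pd K (H y)) (at (H y))"
    using assms(4,5) by (simp_all add: frechet_derivative_works)
  then have "((\<lambda>z. K (H z)) has_derivative (\<lambda>v. pd K (H y) (pd H y v))) (at y)"
    by (rule has_derivative_compose)
  moreover have "((\<lambda>z. K (H z)) has_derivative (\<lambda>v. v)) (at y)"
    by (rule has_derivative_transform_within_open[OF has_derivative_ident assms(1,2)]) (simp add: KH)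
  ultimately have "(\<lambda>v. pd K (H y) (pd H y v)) = (\<lambda>v. v)" by (rule has_derivative_unique)
  then show ?thesis by metis
qed

lemma open_overlap:
  assumes "open (cdom c)" "continuous_map (top_of_set (cdom c)) X (cpar c)"
    "continuous_map X Y F" "openin Y (cimage d)"
  shows "open (overlap F c d)"
proof -
  have "continuous_map (top_of_set (cdom c)) Y (F \<circ> cpar c)"
    using assms(2,3) by (rule continuous_map_compose)
  from openin_continuous_map_preimage[OF this assms(4)]
  have "openin (top_of_set (cdom c)) (overlap F c d)" by (simp add: overlap_def)
  then show ?thesis using assms(1) openin_open_trans by blast
qed

lemma continuous_map_cpar:
  assumes "riemannian_chart X c"
  shows "continuous_map (top_of_set (cdom c)) X (cpar c)"
  using assms homeomorphic_imp_continuous_map continuous_map_in_subtopology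
  unfolding riemannian_chart_def by blast

lemma continuous_map_cpar_warp:
  assumes "riemannian_chart X c"
  shows "continuous_map (top_of_set (cdom (warp_chart w c))) (prod_topology euclidean X)
    (cpar (warp_chart w c))"
proof -
  have "continuous_map (prod_topology euclidean (top_of_set (cdom c))) (prod_topology euclidean X)
      (\<lambda>(t :: real, y). (t, cpar c y))"
    using continuous_map_cpar[OF assms]
    by (simp add: continuous_map_prod_top continuous_map_id[unfolded id_def])
  then show ?thesis by (simp add: warp_chart_def flip: prod_topology_subtopology_eu)
qed

text \<open>A single pair of charts around one point and its image suffices, because
  \<open>no_product_coordinates\<close> is a local statement.\<close>

lemma not_isometric_product_line:
  fixes N :: "('b, 'f::euclidean_space) rmfd"
  assumes N: "riemannian_manifold N"
  shows "\<not> isometric (cusp :: (_, real \<times> (real ^ 'k::finite)) rmfd) (product_line N)"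
proof
  assume "isometric (cusp :: (_, real \<times> (real ^ 'k)) rmfd) (product_line N)"
  then obtain F where F: "riemannian_isometry (cusp :: (_, real \<times> (real ^ 'k)) rmfd) (product_line N) F"
    by (auto simp: isometric_def)
  let ?X = "top_of_set (cyl :: (real \<times> (complex ^ 'k)) set)"
  let ?Y = "prod_topology (euclidean :: real topology) (mtop N)"
  have mN: "mtop (product_line N) = ?Y" "atlas (product_line N) = warp_chart (\<lambda>t. 1) ` atlas N"
    by (simp_all add: product_line_def warped_line_def)
  define G where "G = inv_into cyl F"
  have hom: "homeomorphic_map ?X ?Y F" using F by (simp add: riemannian_isometry_def mtop_cusp mN)
  then have inj: "inj_on F cyl" and im: "F ` cyl = topspace ?Y" and cF: "continuous_map ?X ?Y F"
    by (auto simp: homeomorphic_eq_everything_map simp del: topspace_prod_topology)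
  have GF: "G (F p) = p" if "p \<in> cyl" for p using that inj by (simp add: G_def)
  have FG: "F (G q) = q" "G q \<in> cyl" if "q \<in> topspace ?Y" for q
    using that im unfolding G_def by (metis f_inv_into_f, metis inv_into_into)
  have cG: "continuous_map ?Y ?X G"
  proof -
    obtain G' where G': "homeomorphic_maps ?X ?Y F G'" using hom homeomorphic_map_maps by blast
    then have "G q = G' q" if "q \<in> topspace ?Y" for q
      using that GF FG im unfolding homeomorphic_maps_def
      by (metis continuous_map_image_subset_topspace image_subset_iff topspace_euclidean_subtopology)
    then show ?thesis
      using G' continuous_map_eq unfolding homeomorphic_maps_def by metis
  qed
  have "cyl_par 0 \<in> (cyl :: (real \<times> (complex ^ 'k)) set)" by (rule cyl_par_in_cyl)
  then obtain c where c: "c \<in> atlas cusp" "cyl_par (0 :: real \<times> (real ^ 'k)) \<in> cimage c"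
    using topspace_cusp by blast
  have cc: "cpar c = cyl_par" "open (cdom c)" "cmet c = cusp_metric" "inj_on cyl_par (cdom c)"
    using cusp_chart_atlas[OF c(1)] by metis+
  define q where "q = F (cyl_par (0 :: real \<times> (real ^ 'k)))"
  have "q \<in> topspace ?Y" using im cyl_par_in_cyl unfolding q_def by blast
  then have "snd q \<in> topspace (mtop N)" by auto
  then obtain d0 where d0: "d0 \<in> atlas N" "snd q \<in> cimage d0"
    using N by (auto simp: riemannian_manifold_def)
  then have rc: "riemannian_chart (mtop N) d0" using N by (auto simp: riemannian_manifold_def)
  define d where "d = warp_chart (\<lambda>t. 1) d0"
  have dA: "d \<in> atlas (product_line N)" using d0 by (simp add: mN d_def)
  have dd: "cdom d = UNIV \<times> cdom d0" "cimage d = UNIV \<times> cimage d0"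
    by (auto simp: d_def warp_chart_def cimage_def image_iff)
  have od: "open (cdom d)" using rc by (simp add: dd riemannian_chart_def open_Times)
  have cd: "continuous_map (top_of_set (cdom d)) ?Y (cpar d)"
    unfolding d_def by (rule continuous_map_cpar_warp[OF rc])
  have oid: "openin ?Y (cimage d)"
    using rc by (simp add: dd riemannian_chart_def openin_prod_Times_iff)
  have injd: "inj_on (cpar d) (cdom d)"
  proof -
    have "inj_on (cpar d0) (cdom d0)"
      using rc homeomorphic_imp_injective_map unfolding riemannian_chart_def by fastforce
    then show ?thesis by (auto simp: d_def warp_chart_def inj_on_def)
  qed
  have cpd: "cpar d y \<in> topspace ?Y" if "y \<in> cdom d" for y
    using cd that by (metis continuous_map_image_subset_topspace image_subset_iff topspace_euclidean_subtopology)
  have coordd: "coord d (cpar d y) = y" if "y \<in> cdom d" for y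
    using injd that by (simp add: coord_def)
  define U where "U = overlap G d c"
  define W where "W = overlap F c d"
  \<comment> \<open>The inverse isometry in coordinates: its source carries the product coordinates.
    \<open>K\<close> is \<open>F\<close> itself, for which metric preservation is stated; inverting
    its derivative transfers this to \<open>H\<close>.\<close>
  define H where "H = transition G d c"
  define K where "K = transition F c d"
  have oU: "open U"
    unfolding U_def using od cd cG openin_cimage_cusp[OF c(1)] by (rule open_overlap)
  have oW: "open W"
    unfolding W_def
    using cc(2) continuous_map_cpar[OF riemannian_chart_cusp[OF c(1)]] cF oid by (rule open_overlap)
  have HU: "H y \<in> W \<and> K (H y) = y" if "y \<in> U" for y
  proof -
    have y: "y \<in> cdom d" "G (cpar d y) \<in> cimage c" using that by (auto simp: U_def overlap_def)
    then have "cpar c (H y) = G (cpar d y)" "H y \<in> cdom c"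
      using coord_in_cdom[OF y(2)] by (auto simp: H_def transition_def)
    then show ?thesis
      using FG[OF cpd[OF y(1)]] coordd[OF y(1)] y(1)
      by (auto simp: W_def overlap_def K_def transition_def cimage_def)
  qed
  have KW: "K x \<in> U \<and> H (K x) = x" if "x \<in> W" for x
  proof -
    have x: "x \<in> cdom c" "F (cpar c x) \<in> cimage d" using that by (auto simp: W_def overlap_def)
    then have *: "cpar d (K x) = F (cpar c x)" "K x \<in> cdom d"
      using coord_in_cdom[OF x(2)] by (auto simp: K_def transition_def)
    then have "G (cpar d (K x)) = cpar c x" by (simp add: cc GF[OF cyl_par_in_cyl])
    then show ?thesis
      using * x coord_cusp[OF c(1) x(1)]
      by (auto simp: U_def overlap_def H_def transition_def cimage_def cc)
  qed
  obtain x0 where "x0 \<in> W"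
  proof
    show "coord c (cyl_par 0) \<in> W"
      using coord_in_cdom[OF c(2)] d0(2) dd(2) unfolding W_def overlap_def q_def cc(1)
      by (auto simp: mem_Times_iff)
  qed
  then have U0: "K x0 \<in> U" using KW by blast
  have sm: "smooth_on H U" "smooth_on K W" "metric_preserving_in_charts F c d"
    using F c(1) dA
    by (simp_all add: riemannian_isometry_def smooth_in_charts_def mtop_cusp H_def U_def G_def K_def W_def)
  show False
  proof (rule no_product_coordinates[OF oU U0 sm(1)])
    show "bilinear (cmet d0 (snd y))" if "y \<in> U" for y
      using that rc by (auto simp: U_def overlap_def dd riemannian_chart_def)
    fix y assume y: "y \<in> U"
    have dHK: "H differentiable (at y)" "K differentiable (at (H y))"
      using smooth_on_differentiable(1)[OF sm(1) oU y] smooth_on_differentiable(1)[OF sm(2) oW] HU[OF y]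
      by auto
    show "surj (pd H y)"
      using pd_inverse[OF oW, of "H y" H K] HU[OF y] KW dHK by (metis surjI)
    fix v w
    have "cmet d (K (H y)) (pd K (H y) (pd H y v)) (pd K (H y) (pd H y w))
        = cusp_metric (H y) (pd H y v) (pd H y w)"
      using sm(3) HU[OF y] unfolding metric_preserving_in_charts_def cc(3) W_def[symmetric] K_def[symmetric]
      by blast
    moreover have "pd K (H y) (pd H y u) = u" for u
      using HU dHK by (intro pd_inverse[OF oU y]) auto
    ultimately show "cusp_metric (H y) (pd H y v) (pd H y w)
        = fst v * fst w + cmet d0 (snd y) (snd v) (snd w)"
      using HU[OF y] by (simp add: d_def warp_chart_def case_prod_unfold)
  qed
qed

theorem mainTheorem3:
  fixes n :: nat and \<gamma> :: real
    and M :: "(real \<times> (complex ^ 'k), real \<times> (real ^ 'k)) rmfd"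
  assumes "n \<ge> 2" and "CARD('k::finite) = n - 1"
    and "\<gamma> \<ge> 4 / (real n - 1)"
    and "M = warped_line (\<lambda>t. exp (2 * t)) flat_torus"
  shows "riemannian_manifold M \<and> complete_manifold M \<and>
    lambda1_nonneg_form \<gamma> M \<and> lambda1_nonneg_supersolution \<gamma> M \<and>
    card (ends (mtop M)) = 2 \<and>
    \<not> (\<exists>N :: ('b, 'f::euclidean_space) rmfd.
          riemannian_manifold N \<and> isometric M (product_line N))"
proof -
  have M: "M = cusp" by (simp add: assms(4) cusp_def)
  have "real CARD('k) = real n - 1" using assms(1,2) by simp
  then have \<gamma>: "\<gamma> \<ge> 4 / real CARD('k)" using assms(3) by simp
  show ?thesis
    unfolding M
    using riemannian_manifold_cusp complete_manifold_cusp lambda1_nonneg_form_cusp[OF \<gamma>]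
      lambda1_nonneg_supersolution_cusp[OF \<gamma>] card_ends_cusp not_isometric_product_line
    by blast
qed

end
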